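(* Let $f_{\ell, \alpha, \theta}: \mathbb{T} \to \mathbb{T}$ be the map described in the context, for a given choice of the parameters $\ell>0$, $0 < \alpha < \theta < \pi/2$. Then, for every $\ell$ and Lebesgue-a.e. $(\alpha, \theta)$, \begin{displaymath} \rho(f_{\ell, \alpha, \theta}) \in \mathbb{Q}. \end{displaymath}
   Context: Setting: $f_{\ell,\alpha,\theta}:\mathbb{T}\to\mathbb{T}$ ($\mathbb{T}=\mathbb{R}/\mathbb{Z}$) is the first-return map to a horizontal cross-section of length 1 of the unfolded unit-speed linear flow associated with the internal-wave billiard (reflection keeping equal angles with the vertical) in a rectangular trapezoid of height $1/2$, horizontal bases, vertical left leg, shorter base $\ell$, slanted-leg angle $\alpha$, and initial direction $\theta$ (angle with the vertical). It is an orientation-preserving piecewise-linear circle homeomorphism with derivative taking values $\Lambda^{\pm1}$, $\Lambda=\sin(\theta+\alpha)/\sin(\theta-\alpha)$, and two break points. $\rho$ denotes the Poincaré rotation number. *)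

theory Defs
  imports "HOL-Analysis.Analysis"
begin

text \<open>Coordinates: the trapezoid is {(x,y). 0 \<le> y \<le> 1/2, 0 \<le> x \<le> l + y * tan a},
  i.e. vertical left leg on x = 0, bottom base of length l (the shorter one), top base of length
  l + tan a / 2, slanted right leg making angle a with the vertical.  Unfolding the
  internal-wave billiard across the horizontal bases (the internal-wave reflection law flips the
  vertical velocity component there, and flips the horizontal component at both legs), the
  vertical coordinate becomes a real number y whose position in the trapezoid is fold_height y
  (distance to the nearest integer), and the vertical velocity component is constantly cos t.\<close>

definition fold_height :: "real \<Rightarrow> real" where
  "fold_height y = min (frac y) (1 - frac y)"

definition slant_x :: "real \<Rightarrow> real \<Rightarrow> real \<Rightarrow> real" where
  "slant_x l a y = l + fold_height y * tan a"

definition hit_time :: "real \<Rightarrow> real \<Rightarrow> real \<Rightarrow> real \<Rightarrow> real" where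
  "hit_time l a t y0 = (THE s. 0 < s \<and> s * sin t = slant_x l a (y0 + s * cos t) \<and>
      (\<forall>r. 0 < r \<and> r < s \<longrightarrow> r * sin t < slant_x l a (y0 + r * cos t)))"

text \<open>Lift to the real line of the first-return map f_{l,a,t} to the cross-section
  (left leg, unfolded: a circle of length 1): after reflection at the slanted leg the velocity
  is (- sin t, cos t) and the trajectory returns to x = 0 after the same time again.\<close>
definition trap_lift :: "real \<Rightarrow> real \<Rightarrow> real \<Rightarrow> real \<Rightarrow> real" where
  "trap_lift l a t y0 = y0 + 2 * hit_time l a t y0 * cos t"

definition rotation_number :: "(real \<Rightarrow> real) \<Rightarrow> real" where
  "rotation_number F = frac (lim (\<lambda>n. ((F ^^ n) 0 - 0) / real n))"

end

theory Submission
  imports Defs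
begin

text \<open>
  Put \<open>k = tan a / tan t\<close>, \<open>L = (1 + k) / (1 - k)\<close> and \<open>c = l / tan t\<close>. Up to a translation by \<open>c\<close> the
  return map is \<open>F + \<tau>\<close> with \<open>\<tau> = 2 c\<close>, where \<open>F\<close> is a lift with slopes \<open>L\<close> and \<open>1 / L\<close>, a convex
  break at the integers and a concave break at \<open>b = 1 / (1 + L)\<close> modulo 1. By Fubini and a smooth
  change of parameters it suffices to show, for fixed \<open>L\<close>, that almost every \<open>\<tau>\<close> has rational
  rotation number.

  The point is that an iterate of odd order \<open>q\<close> has slopes that are odd powers of \<open>L\<close>, hence never 1.
  Given \<open>\<tau>\<^sub>0\<close> with irrational translation number \<open>x\<close>, take \<open>q\<close> odd with \<open>\<bar>x - p / q\<bar> < 1 / q\<^sup>2\<close> and the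
  parameter \<open>\<tau>\<^sub>1\<close> for which \<open>b\<close> is periodic of type \<open>p / q\<close>. Its orbit cuts the circle into gaps
  \<open>I\<^sub>1, \<dots>, I\<^sub>q\<close> that are permuted cyclically, affinely except for the one gap containing an integer,
  whose position in that gap is forced by the parity of \<open>q\<close>. With \<open>\<Sigma> = \<Sum>j. 1 / \<bar>I\<^sub>j\<bar>\<close>, a shift of the
  parameter by \<open>s\<close> displaces points, relative to the gaps and over one period, by about \<open>s \<Sigma>\<close>. Hence
  the rotation number is \<open>p / q\<close> on \<open>[\<tau>\<^sub>1, \<tau>\<^sub>1 + \<kappa> / \<Sigma>]\<close> with \<open>\<kappa> = (L - 1) / (L + 1)\<close>, and it differs from
  \<open>p / q\<close> by at least \<open>1 / q\<^sup>2\<close> when the parameter is at distance at least \<open>2 / \<Sigma>\<close> from \<open>\<tau>\<^sub>1\<close>. So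
  \<open>\<tau>\<^sub>0\<close> lies in an arbitrarily short interval of which a fixed proportion consists of rational
  parameters, and the Vitali covering theorem shows that the irrational parameters form a null set.
\<close>

section \<open>Translation numbers and odd approximations\<close>

definition translation_number :: "(real \<Rightarrow> real) \<Rightarrow> real" where
  "translation_number f = lim (\<lambda>n. (f ^^ n) 0 / real n)"

locale circle_lift =
  fixes f :: "real \<Rightarrow> real"
  assumes strict: "x < y \<Longrightarrow> f x < f y"
    and shift1: "f (x + 1) = f x + 1"
begin

lemma shift_nat: "f (x + real n) = f x + real n"
proof (induction n)
  case (Suc n)
  have "f (x + real (Suc n)) = f ((x + real n) + 1)" by (simp add: algebra_simps)
  then show ?case using Suc shift1[of "x + real n"] by simp
qed simp

lemma shift: "f (x + of_int m) = f x + of_int m"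
proof (cases "m \<ge> 0")
  case True
  then show ?thesis using shift_nat[of x "nat m"] by simp
next
  case False
  then show ?thesis using shift_nat[of "x + of_int m" "nat (- m)"] by simp
qed

lemma iter_shift: "(f ^^ n) (x + of_int m) = (f ^^ n) x + of_int m"
  by (induction n) (auto simp: shift)

lemma iter_strict: "x < y \<Longrightarrow> (f ^^ n) x < (f ^^ n) y"
  by (induction n) (auto simp: strict)

lemma iter_mono: "x \<le> y \<Longrightarrow> (f ^^ n) x \<le> (f ^^ n) y"
  using iter_strict by (metis le_less)

text \<open>Squeeze \<open>x\<close> between consecutive integers: monotonicity and commutation with
  integer translations compare its orbit with that of 0.\<close>

lemma iter_displacement: "\<bar>(f ^^ n) x - x - (f ^^ n) 0\<bar> \<le> 1"
proof -
  define m where "m = \<lfloor>x\<rfloor>"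
  have m: "of_int m \<le> x" "x \<le> of_int (m + 1)" unfolding m_def by linarith+
  have "(f ^^ n) 0 + of_int m \<le> (f ^^ n) x"
    using iter_mono[OF m(1), of n] iter_shift[of n 0 m] by simp
  moreover have "(f ^^ n) x \<le> (f ^^ n) 0 + of_int (m + 1)"
    using iter_mono[OF m(2), of n] iter_shift[of n 0 "m + 1"] by simp
  ultimately show ?thesis using m by (simp add: abs_le_iff)
qed

lemma iter_mult_displacement: "\<bar>(f ^^ (m * n)) 0 - real n * (f ^^ m) 0\<bar> \<le> real n"
proof (induction n)
  case (Suc n)
  have "(f ^^ (m * Suc n)) 0 = (f ^^ m) ((f ^^ (m * n)) 0)"
    by (simp add: funpow_add)
  then show ?case
    using Suc iter_displacement[of m "(f ^^ (m * n)) 0"] by (simp add: algebra_simps abs_le_iff)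
qed simp

text \<open>The averages at \<open>m\<close> and at \<open>n\<close> are both compared with the one
  at \<open>m * n\<close>; the resulting bound \<open>1 / m + 1 / n\<close> is a Cauchy
  estimate.\<close>

lemma convergent_iter: "convergent (\<lambda>n. (f ^^ n) 0 / real n)"
proof -
  let ?a = "\<lambda>n. (f ^^ n) 0 / real n"
  have mult: "\<bar>?a (m * n) - ?a m\<bar> \<le> 1 / real m" if "m > 0" "n > 0" for m n
  proof -
    have "?a (m * n) - ?a m = ((f ^^ (m * n)) 0 - real n * (f ^^ m) 0) / (real m * real n)"
      using that by (simp add: field_simps)
    also have "\<bar>\<dots>\<bar> \<le> real n / (real m * real n)"
      using divide_right_mono[OF iter_mult_displacement[of m n], of "real m * real n"]
      by (simp add: abs_mult)
    also have "\<dots> = 1 / real m" using that by simp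
    finally show ?thesis .
  qed
  have diff: "\<bar>?a m - ?a n\<bar> \<le> 1 / real m + 1 / real n" if "m > 0" "n > 0" for m n
    using mult[OF that] mult[OF that(2,1)] unfolding mult.commute[of n m] by linarith
  have "Cauchy ?a"
  proof (rule metric_CauchyI)
    fix e :: real assume "e > 0"
    then obtain N where N: "N > 0" "inverse (real N) < e / 2"
      using reals_Archimedean2 ex_inverse_of_nat_less half_gt_zero by blast
    show "\<exists>M. \<forall>m\<ge>M. \<forall>n\<ge>M. dist (?a m) (?a n) < e"
    proof (intro exI allI impI)
      fix m n assume "N \<le> m" "N \<le> n"
      then have "1 / real m \<le> inverse (real N)" "1 / real n \<le> inverse (real N)" "m > 0" "n > 0"
        using N by (auto simp: field_simps)
      then show "dist (?a m) (?a n) < e"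
        using diff[of m n] N unfolding dist_real_def by linarith
    qed
  qed
  then show ?thesis by (simp add: Cauchy_convergent_iff)
qed

lemma tendsto_translation_number: "(\<lambda>n. ((f ^^ n) x - x) / real n) \<longlonglongrightarrow> translation_number f"
proof -
  have 0: "(\<lambda>n. (f ^^ n) 0 / real n) \<longlonglongrightarrow> translation_number f"
    unfolding translation_number_def using convergent_iter by (simp add: convergent_LIMSEQ_iff)
  have "(\<lambda>n. ((f ^^ n) x - x) / real n - (f ^^ n) 0 / real n) \<longlonglongrightarrow> 0"
  proof (rule Lim_null_comparison)
    show "\<forall>\<^sub>F n in sequentially. norm (((f ^^ n) x - x) / real n - (f ^^ n) 0 / real n) \<le> 1 / real n"
    proof (rule always_eventually, rule allI)
      fix n
      have "((f ^^ n) x - x) / real n - (f ^^ n) 0 / real n = ((f ^^ n) x - x - (f ^^ n) 0) / real n"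
        by (simp add: diff_divide_distrib)
      then show "norm (((f ^^ n) x - x) / real n - (f ^^ n) 0 / real n) \<le> 1 / real n"
        using iter_displacement[of n x] by (simp add: divide_right_mono)
    qed
  qed (rule lim_1_over_n)
  from tendsto_add[OF this 0] show ?thesis by simp
qed

lemma tendsto_translation_number_mult:
  assumes "q > 0"
  shows "(\<lambda>n. ((f ^^ (q * n)) x - x) / real n) \<longlonglongrightarrow> real q * translation_number f"
proof -
  have "strict_mono (\<lambda>n. q * n)" using assms by (simp add: strict_mono_def)
  from LIMSEQ_subseq_LIMSEQ[OF tendsto_translation_number[of x] this]
  have "(\<lambda>n. real q * (((f ^^ (q * n)) x - x) / real (q * n))) \<longlonglongrightarrow> real q * translation_number f"
    by (intro tendsto_mult_left) (simp add: o_def)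
  then show ?thesis using assms by simp
qed

text \<open>Testing a single point is enough, because monotonicity propagates the inequality along
  all multiples of \<open>q\<close>.\<close>

lemma translation_number_le:
  assumes q: "q > 0" and x: "(f ^^ q) x \<le> x + of_int p"
  shows "translation_number f \<le> of_int p / real q"
proof -
  have it: "(f ^^ (q * n)) x \<le> x + of_int (int n * p)" for n
  proof (induction n)
    case (Suc n)
    have "(f ^^ (q * Suc n)) x = (f ^^ q) ((f ^^ (q * n)) x)" by (simp add: funpow_add)
    also have "\<dots> \<le> (f ^^ q) (x + of_int (int n * p))" by (rule iter_mono[OF Suc])
    also have "\<dots> \<le> x + of_int (int (Suc n) * p)"
      unfolding iter_shift using x by (simp add: algebra_simps)
    finally show ?case .
  qed simp
  have "real q * translation_number f \<le> of_int p"
  proof (rule LIMSEQ_le_const2[OF tendsto_translation_number_mult[OF q]], intro exI allI impI)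
    fix n :: nat assume "n \<ge> 1"
    then show "((f ^^ (q * n)) x - x) / real n \<le> of_int p"
      using it[of n] by (simp add: field_simps)
  qed
  then show ?thesis using q by (simp add: field_simps)
qed

lemma translation_number_ge:
  assumes q: "q > 0" and x: "(f ^^ q) x \<ge> x + of_int p"
  shows "translation_number f \<ge> of_int p / real q"
proof -
  have it: "(f ^^ (q * n)) x \<ge> x + of_int (int n * p)" for n
  proof (induction n)
    case (Suc n)
    have "x + of_int (int (Suc n) * p) \<le> (f ^^ q) (x + of_int (int n * p))"
      unfolding iter_shift using x by (simp add: algebra_simps)
    also have "\<dots> \<le> (f ^^ q) ((f ^^ (q * n)) x)" by (rule iter_mono[OF Suc])
    also have "\<dots> = (f ^^ (q * Suc n)) x" by (simp add: funpow_add)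
    finally show ?case .
  qed simp
  have "real q * translation_number f \<ge> of_int p"
  proof (rule LIMSEQ_le_const[OF tendsto_translation_number_mult[OF q]], intro exI allI impI)
    fix n :: nat assume "n \<ge> 1"
    then show "((f ^^ (q * n)) x - x) / real n \<ge> of_int p"
      using it[of n] by (simp add: field_simps)
  qed
  then show ?thesis using q by (simp add: field_simps)
qed

end

lemma frac_in_Rats_iff: "frac x \<in> \<rat> \<longleftrightarrow> x \<in> \<rat>"
proof
  assume "frac x \<in> \<rat>"
  then have "frac x + of_int \<lfloor>x\<rfloor> \<in> \<rat>" by (intro Rats_add Rats_of_int)
  then show "x \<in> \<rat>" by (simp add: frac_def)
qed (simp add: frac_def)

section \<open>Rational approximations with odd denominator\<close>

lemma irrational_bounded_away_from_int:
  fixes x :: real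
  assumes irr: "x \<notin> \<rat>"
  obtains d where "d > 0" "\<And>j m. 0 < j \<Longrightarrow> j \<le> N \<Longrightarrow> d < \<bar>real j * x - of_int m\<bar>"
proof -
  define ds where "ds = (\<lambda>j. \<bar>real j * x - of_int (round (real j * x))\<bar>) ` {1..N}"
  \<comment> \<open>The inserted 1 keeps the set nonempty when \<open>N = 0\<close>; halving makes
    the final inequality strict.\<close>
  define d where "d = Min (insert 1 ds) / 2"
  have irrj: "real j * x \<noteq> of_int m" if "j > 0" for j m
  proof
    assume "real j * x = of_int m"
    then have "x = of_int m / of_nat j" using that by (simp add: field_simps)
    then show False using irr by simp
  qed
  have fin: "finite (insert 1 ds)" unfolding ds_def by simp
  have "\<forall>y\<in>insert 1 ds. 0 < y" unfolding ds_def using irrj by auto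
  then have pos: "Min (insert 1 ds) > 0" using fin by (simp add: Min_gr_iff)
  show thesis
  proof (rule that)
    show "d > 0" using pos by (simp add: d_def)
    fix j m assume "0 < j" "j \<le> N"
    then have "\<bar>real j * x - of_int (round (real j * x))\<bar> \<in> insert 1 ds"
      unfolding ds_def by auto
    from Min_le[OF fin this] have "d < \<bar>real j * x - of_int (round (real j * x))\<bar>"
      using pos unfolding d_def by simp
    also have "\<dots> \<le> \<bar>real j * x - of_int m\<bar>"
      using round_diff_minimal[of "real j * x" m] by simp
    finally show "d < \<bar>real j * x - of_int m\<bar>" .
  qed
qed

text \<open>Reducing a Bezout coefficient modulo \<open>k\<close> gives the small denominator, and
  \<open>k\<close> even with \<open>s\<close> odd forces it to be odd. The sign \<open>s\<close>
  selects the side of \<open>h / k\<close> on which this Farey neighbour lies.\<close>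

lemma coprime_odd_neighbour:
  fixes h k s :: int
  assumes "coprime h k" "1 < k" "even k" "s = 1 \<or> s = -1"
  obtains p' q' where "0 < q'" "q' < k" "q' * h - p' * k = s" "odd q'" "coprime p' q'"
proof -
  obtain u v where uv: "u * h + v * k = 1"
    using assms(1) bezout_int[of h k] by auto
  define q' where "q' = (s * u) mod k"
  define p' where "p' = - (s * v + (s * u div k) * h)"
  have "s * u = (s * u div k) * k + q'" unfolding q'_def by simp
  then have "q' = s * u - (s * u div k) * k" by simp
  then have "q' * h - p' * k = s * (u * h + v * k)" unfolding p'_def by algebra
  then have eq: "q' * h - p' * k = s" using uv by simp
  have "odd q'"
  proof
    assume "even q'"
    then have "even s" using eq assms(3) by (metis dvd_diff dvd_mult dvd_mult2)
    then show False using assms(4) by auto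
  qed
  moreover have "0 \<le> q'" "q' < k" using assms(2) unfolding q'_def by auto
  moreover have "coprime p' q'"
  proof (rule coprimeI)
    fix c assume "c dvd p'" "c dvd q'"
    then have "c dvd s" using eq by (metis dvd_diff dvd_mult2)
    then show "is_unit c" using assms(4) by auto
  qed
  ultimately show thesis using that[of q' p'] eq by (cases "q' = 0") auto
qed

text \<open>If the denominator of a Dirichlet approximation is even, then both of its Farey neighbours with
  smaller denominator have odd denominator. For the neighbour on the same side as \<open>x\<close> the two error
  terms have opposite signs, so the quality of the approximation is not lost.\<close>

lemma irrational_odd_approximation:
  fixes x :: real
  assumes irr: "x \<notin> \<rat>"
  obtains p :: int and q :: nat
  where "odd q" "coprime p (int q)" "N \<le> q" "\<bar>real q * x - of_int p\<bar> < 1 / real q"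
proof -
  obtain d where d: "d > 0" "\<And>j m. 0 < j \<Longrightarrow> j \<le> N \<Longrightarrow> d < \<bar>real j * x - of_int m\<bar>"
    using irrational_bounded_away_from_int[OF irr] by blast
  obtain n0 :: nat where n0: "n0 > 0" "1 / real n0 < d"
    using d by (metis inverse_eq_divide ex_inverse_of_nat_less)
  \<comment> \<open>In the even case the denominator drops from \<open>q\<close> to
    \<open>q'\<close>. Beyond \<open>n0\<close> the error \<open>1 / q\<close> is below
    \<open>d\<close>, and this still keeps \<open>q'\<close> above \<open>N\<close>.\<close>
  define N1 where "N1 = max N n0"
  obtain d1 where d1: "d1 > 0" "\<And>j m. 0 < j \<Longrightarrow> j \<le> N1 \<Longrightarrow> d1 < \<bar>real j * x - of_int m\<bar>"
    using irrational_bounded_away_from_int[OF irr] by blast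
  obtain M :: nat where M: "M > 0" "1 / real M < d1"
    using d1 by (metis inverse_eq_divide ex_inverse_of_nat_less)
  obtain h k where hk: "coprime h k" "0 < k" "k \<le> int M" "\<bar>of_int k * x - of_int h\<bar> < 1 / real M"
    using Dirichlet_approx_coprime[OF M(1), of x] .
  define q where "q = nat k"
  have q: "q > 0" "q \<le> M" "int q = k" "real q = of_int k" using hk unfolding q_def by auto
  have hkq: "\<bar>real q * x - of_int h\<bar> < 1 / real M" using hk q by simp
  have iM: "1 / real M \<le> 1 / real q" using q M by (simp add: field_simps)
  have qN1: "N1 < q"
  proof (rule ccontr)
    assume "\<not> N1 < q"
    then show False using d1(2)[of q h] hkq M(2) q(1) by simp
  qed
  show thesis
  proof (cases "odd q")
    case True
    show thesis
    proof (rule that[OF True, of h])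
      show "coprime h (int q)" using hk(1) unfolding q(3) .
      show "N \<le> q" using qN1 N1_def by simp
      show "\<bar>real q * x - of_int h\<bar> < 1 / real q" using hkq iM by simp
    qed
  next
    case False
    define e where "e = real q * x - of_int h"
    define s :: int where "s = (if e > 0 then -1 else 1)"
    have k: "1 < k" "even k" using False q(1) unfolding q(3)[symmetric] by (auto elim: evenE)
    obtain p' k' where k': "0 < k'" "k' < k" "k' * h - p' * k = s" "odd k'" "coprime p' k'"
    proof -
      have "s = 1 \<or> s = -1" by (simp add: s_def)
      from coprime_odd_neighbour[OF hk(1) k this] that show thesis by metis
    qed
    define q' where "q' = nat k'"
    have q': "q' > 0" "q' < q" "int q' = k'" "real q' = of_int k'" using k' q unfolding q'_def by auto
    have s': "real q' * of_int h - of_int p' * real q = of_int s"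
      using arg_cong[OF k'(3), of real_of_int] q q' by simp
    have "real q * (real q' * x - of_int p') = of_int s + real q' * e"
      unfolding e_def s'[symmetric] by (simp add: algebra_simps)
    moreover have "\<bar>of_int s + real q' * e\<bar> \<le> 1"
    proof -
      have "\<bar>real q' * e\<bar> \<le> real q' * (1 / real q)"
        unfolding abs_mult using hkq iM q' unfolding e_def by (intro mult_mono) auto
      also have "\<dots> \<le> 1" using q' by simp
      finally have "\<bar>real q' * e\<bar> \<le> 1" .
      moreover have "e > 0 \<Longrightarrow> real q' * e \<ge> 0" "\<not> e > 0 \<Longrightarrow> real q' * e \<le> 0"
        using q' by (auto simp: mult_nonneg_nonpos)
      ultimately show ?thesis unfolding s_def by (auto simp: abs_le_iff)
    qed
    ultimately have "real q * \<bar>real q' * x - of_int p'\<bar> \<le> 1"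
      by (metis abs_mult abs_of_nat)
    then have err: "\<bar>real q' * x - of_int p'\<bar> \<le> 1 / real q" using q by (simp add: field_simps)
    show thesis
    proof (rule that[of q' p'])
      show "odd q'" using k'(4) unfolding q'(3)[symmetric] by simp
      show "coprime p' (int q')" using k'(5) unfolding q'(3) .
      have "1 / real q < 1 / real q'" using q' q by (simp add: field_simps)
      then show "\<bar>real q' * x - of_int p'\<bar> < 1 / real q'" using err by simp
      have "1 / real q \<le> 1 / real n0" using qN1 n0 unfolding N1_def by (simp add: field_simps)
      then have "\<bar>real q' * x - of_int p'\<bar> < d" using err n0(2) by simp
      then have "\<not> q' \<le> N" using d(2)[OF q'(1), of p'] by (intro notI) linarith
      then show "N \<le> q'" by simp
    qed
  qed
qed

section \<open>A family of circle maps with two slopes\<close>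

text \<open>In each unit cell the line of slope \<open>L\<close> from the left corner and the line
  of slope \<open>1 / L\<close> into the right corner cross at \<open>pl_break L\<close>; the
  minimum selects the branch.\<close>

definition pl_lift :: "real \<Rightarrow> real \<Rightarrow> real" where
  "pl_lift L x = of_int \<lfloor>x\<rfloor> + min (L * frac x) (1 - (1 - frac x) / L)"

definition pl_break :: "real \<Rightarrow> real" where
  "pl_break L = 1 / (1 + L)"

definition pl_family :: "real \<Rightarrow> real \<Rightarrow> real \<Rightarrow> real" where
  "pl_family L \<tau> x = pl_lift L x + \<tau>"

context
  fixes L :: real
  assumes L: "1 < L"
begin

lemma pl_break_bounds: "0 < pl_break L" "pl_break L < 1"
  using L by (auto simp: pl_break_def)

lemma pl_break_eq: "1 - pl_break L = L * pl_break L"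
  using L by (simp add: pl_break_def field_simps)

text \<open>The two lines differ by a positive multiple of \<open>pl_break L - w\<close>.\<close>

lemma min_branch:
  "w \<le> pl_break L \<Longrightarrow> min (L * w) (1 - (1 - w) / L) = L * w"
  "pl_break L \<le> w \<Longrightarrow> min (L * w) (1 - (1 - w) / L) = 1 - (1 - w) / L"
proof -
  have "(L - 1) * (1 + L) / L * (pl_break L - w) = (L - 1) / L * (pl_break L + L * pl_break L - (1 + L) * w)"
    using L by (simp add: field_simps)
  also have "\<dots> = 1 - (1 - w) / L - L * w"
    unfolding pl_break_eq[symmetric] using L by (simp add: field_simps)
  finally have "1 - (1 - w) / L - L * w = (L - 1) * (1 + L) / L * (pl_break L - w)" by simp
  moreover have "(L - 1) * (1 + L) / L > 0" using L by simp
  ultimately show "w \<le> pl_break L \<Longrightarrow> min (L * w) (1 - (1 - w) / L) = L * w"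
    and "pl_break L \<le> w \<Longrightarrow> min (L * w) (1 - (1 - w) / L) = 1 - (1 - w) / L"
    by (smt (verit) mult_nonneg_nonneg mult_nonneg_nonpos)+
qed

lemma pl_lift_left:
  assumes "of_int n \<le> x" "x \<le> of_int n + pl_break L"
  shows "pl_lift L x = of_int n + L * (x - of_int n)"
proof -
  have "\<lfloor>x\<rfloor> = n" using assms pl_break_bounds by (simp add: floor_eq_iff)
  then show ?thesis using assms min_branch(1)[of "x - of_int n"] by (simp add: pl_lift_def frac_def)
qed

lemma pl_lift_right:
  assumes "of_int n + pl_break L \<le> x" "x \<le> of_int n + 1"
  shows "pl_lift L x = of_int n + 1 - (of_int n + 1 - x) / L"
\<comment> \<open>At the right end the floor has already jumped to the next cell, but both formulas
  give \<open>n + 1\<close>.\<close>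
proof (cases "x = of_int n + 1")
  case True
  then show ?thesis using L by (simp add: pl_lift_def frac_def)
next
  case False
  then have "\<lfloor>x\<rfloor> = n" using assms pl_break_bounds by (simp add: floor_eq_iff)
  then show ?thesis using assms min_branch(2)[of "x - of_int n"]
    by (simp add: pl_lift_def frac_def algebra_simps)
qed

lemma pl_lift_int [simp]: "pl_lift L (of_int n) = of_int n"
  using L by (simp add: pl_lift_def)

lemma pl_lift_shift1: "pl_lift L (x + 1) = pl_lift L x + 1"
  by (simp add: pl_lift_def frac_def)

lemma pl_lift_diff_same_cell:
  assumes "of_int n \<le> x" "x < y" "y \<le> of_int n + 1"
  shows "0 < pl_lift L y - pl_lift L x" "pl_lift L y - pl_lift L x \<le> L * (y - x)"
proof -
  let ?b = "of_int n + pl_break L"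
  have sl: "d / L \<le> L * d" if "d \<ge> 0" for d
    using that L mult_mono[of 1 L 1 L] mult_left_mono[of 1 "L * L" d] by (simp add: field_simps)
  consider "y \<le> ?b" | "?b \<le> x" | "x < ?b" "?b < y" using assms by linarith
  then have "0 < pl_lift L y - pl_lift L x \<and> pl_lift L y - pl_lift L x \<le> L * (y - x)"
  proof cases
    case 1
    then have "pl_lift L y - pl_lift L x = L * (y - x)"
      using assms pl_lift_left[of n x] pl_lift_left[of n y] by (simp add: algebra_simps)
    then show ?thesis using assms L by simp
  next
    case 2
    then have "pl_lift L y - pl_lift L x = (y - x) / L"
      using assms L pl_lift_right[of n x] pl_lift_right[of n y] by (simp add: field_simps)
    then show ?thesis using assms L sl[of "y - x"] by simp
  next
    case 3
    have "pl_lift L y - pl_lift L x = L * (?b - x) + (y - ?b) / L"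
    proof -
      have "(of_int n + 1 - y) / L = (1 - pl_break L) / L - (y - ?b) / L"
        by (simp add: diff_divide_distrib add_divide_distrib)
      also have "(1 - pl_break L) / L = pl_break L" using L pl_break_eq by simp
      finally show ?thesis
        using 3 assms pl_lift_left[of n x] pl_lift_right[of n y] pl_break_eq
        by (simp add: algebra_simps)
    qed
    moreover have "0 < L * (?b - x)" "0 < (y - ?b) / L" using 3 L by auto
    moreover have "(y - ?b) / L \<le> L * (y - ?b)" using sl[of "y - ?b"] 3 by simp
    moreover have "L * (?b - x) + L * (y - ?b) = L * (y - x)" by (simp add: algebra_simps)
    ultimately show ?thesis by linarith
  qed
  then show "0 < pl_lift L y - pl_lift L x" "pl_lift L y - pl_lift L x \<le> L * (y - x)" by auto
qed

text \<open>Cut the interval at integers, which are fixed points, and add up the pieces. Strict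
  monotonicity and the Lipschitz constant \<open>L\<close> come out together.\<close>

lemma pl_lift_diff:
  assumes "x < y"
  shows "0 < pl_lift L y - pl_lift L x \<and> pl_lift L y - pl_lift L x \<le> L * (y - x)"
proof (cases "y \<le> of_int \<lfloor>x\<rfloor> + 1")
  case True
  then show ?thesis using pl_lift_diff_same_cell[of "\<lfloor>x\<rfloor>" x y] assms by simp
next
  case False
  define m n where "m = \<lfloor>x\<rfloor> + 1" and "n = \<lfloor>y\<rfloor>"
  have m: "x < of_int m" "of_int (m - 1) \<le> x" unfolding m_def by linarith+
  have n: "of_int n \<le> y" "y \<le> of_int n + 1" unfolding n_def by linarith+
  have mn: "m \<le> n" using False unfolding m_def n_def by linarith
  have 1: "0 < of_int m - pl_lift L x" "of_int m - pl_lift L x \<le> L * (of_int m - x)"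
    using pl_lift_diff_same_cell[of "m - 1" x "of_int m"] m by auto
  have 2: "0 \<le> pl_lift L y - of_int n" "pl_lift L y - of_int n \<le> L * (y - of_int n)"
    using pl_lift_diff_same_cell[of n "of_int n" y] n by (cases "y = of_int n"; force)+
  have "of_int (n - m) \<le> L * of_int (n - m)"
    using mn L mult_right_mono[of 1 L "of_int (n - m)"] by simp
  then have 3: "of_int n - of_int m \<le> L * (of_int n - of_int m)" by simp
  have "L * (y - x) = L * (of_int m - x) + L * (of_int n - of_int m) + L * (y - of_int n)"
    by (simp add: algebra_simps)
  moreover have "real_of_int m \<le> of_int n" using mn by simp
  ultimately show ?thesis using 1 2 3 by linarith
qed

lemma circle_lift_pl_family: "circle_lift (pl_family L \<tau>)"
proof
  show "x < y \<Longrightarrow> pl_family L \<tau> x < pl_family L \<tau> y" for x y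
    using pl_lift_diff[of x y] by (simp add: pl_family_def)
  show "pl_family L \<tau> (x + 1) = pl_family L \<tau> x + 1" for x
    by (simp add: pl_family_def pl_lift_shift1)
qed

lemma continuous_pl_lift: "continuous_on UNIV (pl_lift L)"
proof (rule lipschitz_on_continuous_on)
  show "L-lipschitz_on UNIV (pl_lift L)"
  proof (rule lipschitz_onI)
    show "dist (pl_lift L x) (pl_lift L y) \<le> L * dist x y" for x y
      using pl_lift_diff[of x y] pl_lift_diff[of y x]
      by (cases x y rule: linorder_cases) (auto simp: dist_real_def)
  qed (use L in simp)
qed

lemma pl_lift_near_id: "x - 1 \<le> pl_lift L x" "pl_lift L x \<le> x + 1"
proof -
  have f: "0 \<le> frac x" "frac x < 1" by (auto simp: frac_lt_1)
  moreover have "1 - frac x \<le> L" using f L by linarith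
  ultimately have "0 \<le> L * frac x" "0 \<le> (1 - frac x) / L" "(1 - frac x) / L \<le> 1"
    using L by auto
  then have "0 \<le> min (L * frac x) (1 - (1 - frac x) / L)"
    "min (L * frac x) (1 - (1 - frac x) / L) \<le> 1" by auto
  moreover have "x = of_int \<lfloor>x\<rfloor> + frac x" by (simp add: frac_def)
  ultimately show "x - 1 \<le> pl_lift L x" "pl_lift L x \<le> x + 1"
    using f unfolding pl_lift_def by linarith+
qed

lemma pl_lift_affine:
  assumes xy: "x < y"
    and noint: "\<And>n. \<not> (x < of_int n \<and> of_int n < y)"
    and nobreak: "\<And>n. \<not> (x < pl_break L + of_int n \<and> pl_break L + of_int n < y)"
  obtains \<sigma> where "\<sigma> = L \<or> \<sigma> = 1 / L"
    "\<And>w. x \<le> w \<Longrightarrow> w \<le> y \<Longrightarrow> pl_lift L w = pl_lift L x + \<sigma> * (w - x)"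
proof -
  define n where "n = \<lfloor>x\<rfloor>"
  have n: "of_int n \<le> x" "x < of_int n + 1" unfolding n_def by linarith+
  have y: "y \<le> of_int n + 1" using noint[of "n + 1"] n by force
  show thesis
  proof (cases "x < of_int n + pl_break L")
    case True
    then have "y \<le> of_int n + pl_break L" using nobreak[of n] by force
    then have *: "pl_lift L w = pl_lift L x + L * (w - x)" if "x \<le> w" "w \<le> y" for w
      using pl_lift_left[of n w] pl_lift_left[of n x] True n that by (simp add: algebra_simps)
    show thesis by (rule that[of L, OF _ *]) simp_all
  next
    case False
    then have *: "pl_lift L w = pl_lift L x + 1 / L * (w - x)" if "x \<le> w" "w \<le> y" for w
      using pl_lift_right[of n w] pl_lift_right[of n x] n y that
      by (simp add: diff_divide_distrib add_divide_distrib)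
    show thesis by (rule that[of "1 / L", OF _ *]) simp_all
  qed
qed

text \<open>The \<open>q\<close>-th iterate depends continuously on \<open>\<tau>\<close> and
  displaces \<open>x\<close> by \<open>q * \<tau>\<close> up to an error of at most
  \<open>q\<close>, so the intermediate value theorem applies.\<close>

lemma ex_periodic_parameter:
  assumes "q > 0"
  obtains \<tau> where "(pl_family L \<tau> ^^ q) x = x + of_int p"
proof -
  have cont: "continuous_on UNIV (\<lambda>\<tau>. (pl_family L \<tau> ^^ n) x)" for n
  proof (induction n)
    case (Suc n)
    have "continuous_on UNIV (\<lambda>\<tau>. pl_lift L ((pl_family L \<tau> ^^ n) x) + \<tau>)"
      by (intro continuous_intros continuous_on_compose2[OF continuous_pl_lift Suc]) auto
    then show ?case by (simp add: pl_family_def[of _ _ "(pl_family L _ ^^ n) x"])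
  qed simp
  have low: "(pl_family L \<tau> ^^ n) x \<le> x + real n * (\<tau> + 1)" for \<tau> n
  proof (induction n)
    case (Suc n)
    then show ?case using pl_lift_near_id(2)[of "(pl_family L \<tau> ^^ n) x"]
      by (simp add: pl_family_def[of _ _ "(pl_family L \<tau> ^^ n) x"] algebra_simps)
  qed simp
  have upp: "(pl_family L \<tau> ^^ n) x \<ge> x + real n * (\<tau> - 1)" for \<tau> n
  proof (induction n)
    case (Suc n)
    then show ?case using pl_lift_near_id(1)[of "(pl_family L \<tau> ^^ n) x"]
      by (simp add: pl_family_def[of _ _ "(pl_family L \<tau> ^^ n) x"] algebra_simps)
  qed simp
  \<comment> \<open>At \<open>\<tau> = - M - 1\<close> and \<open>\<tau> = M + 1\<close> the
    displacement is at most \<open>- q * M\<close> and at least \<open>q * M\<close>, which encloses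
    \<open>p\<close>.\<close>
  define M where "M = \<bar>real_of_int p\<bar>"
  have "M \<ge> 0" "real q \<ge> 1" using assms by (auto simp: M_def)
  then have qM: "M \<le> real q * M" using mult_right_mono[of 1 "real q" M] by simp
  have "\<exists>\<tau>. - M - 1 \<le> \<tau> \<and> \<tau> \<le> M + 1 \<and> (pl_family L \<tau> ^^ q) x = x + of_int p"
  proof (rule IVT')
    show "(pl_family L (- M - 1) ^^ q) x \<le> x + of_int p"
      using low[where \<tau>="- M - 1" and n=q] qM unfolding M_def by (auto simp: algebra_simps)
    show "x + of_int p \<le> (pl_family L (M + 1) ^^ q) x"
      using upp[where \<tau>="M + 1" and n=q] qM unfolding M_def by (auto simp: algebra_simps)
    show "- M - 1 \<le> M + 1" by (simp add: M_def)
    show "continuous_on {- M - 1..M + 1} (\<lambda>\<tau>. (pl_family L \<tau> ^^ q) x)"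
      by (rule continuous_on_subset[OF cont]) simp
  qed
  then show thesis using that by blast
qed

end

section \<open>Gaps of a periodic orbit of the break point\<close>

locale periodic_break =
  fixes L \<tau> :: real and q :: nat and p :: int
  assumes L: "1 < L"
    and oddq: "odd q"
    and coprime: "coprime p (int q)"
    and periodic: "(pl_family L \<tau> ^^ q) (pl_break L) = pl_break L + of_int p"
begin

abbreviation "g \<equiv> pl_family L \<tau>"
abbreviation "b \<equiv> pl_break L"

sublocale g: circle_lift g
  by (rule circle_lift_pl_family[OF L])

text \<open>With all integer translates included, this is the preimage in the line of a periodic
  orbit on the circle, so arcs between neighbours become ordinary intervals.\<close>

definition orb :: "real set" where
  "orb = {(g ^^ j) b + of_int m | j m. True}"

definition gap :: "real \<Rightarrow> real \<Rightarrow> bool" where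
  "gap y z \<longleftrightarrow> y \<in> orb \<and> z \<in> orb \<and> y < z \<and> {y<..<z} \<inter> orb = {}"

lemma q_pos: "q > 0"
  using oddq by (cases q) auto

lemma break_in_orb: "b \<in> orb"
  unfolding orb_def by (rule CollectI, rule exI[of _ 0], rule exI[of _ 0]) simp

lemma orb_shift: "x \<in> orb \<Longrightarrow> x + of_int m \<in> orb"
  unfolding orb_def by (auto, metis add.assoc of_int_add)

lemma orb_map: "x \<in> orb \<Longrightarrow> g x \<in> orb"
  unfolding orb_def by (auto simp: g.shift) (metis comp_apply funpow.simps(2))

lemma orb_iter: "x \<in> orb \<Longrightarrow> (g ^^ n) x \<in> orb"
  by (induction n) (auto simp: orb_map)

lemma orb_periodic: "x \<in> orb \<Longrightarrow> (g ^^ q) x = x + of_int p"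
proof -
  assume "x \<in> orb"
  then obtain j m where x: "x = (g ^^ j) b + of_int m" unfolding orb_def by auto
  have "(g ^^ q) ((g ^^ j) b) = (g ^^ j) ((g ^^ q) b)"
    by (metis add.commute comp_apply funpow_add)
  then show ?thesis unfolding x g.iter_shift periodic by simp
qed

lemma orb_periodic_mult: "x \<in> orb \<Longrightarrow> (g ^^ (q * n)) x = x + of_int (int n * p)"
proof (induction n)
  case (Suc n)
  have "(g ^^ (q * Suc n)) x = (g ^^ q) ((g ^^ (q * n)) x)" by (simp add: funpow_add)
  also have "\<dots> = (g ^^ q) x + of_int (int n * p)"
    unfolding Suc.IH[OF Suc.prems] by (rule g.iter_shift)
  finally show ?case using orb_periodic[OF Suc.prems] by (simp add: algebra_simps)
qed simp

text \<open>On the orbit, \<open>g\<close> is inverted by its iterate of order \<open>q - 1\<close>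
  followed by the translation by \<open>- p\<close>; injectivity of \<open>g\<close> does the
  rest.\<close>

lemma orb_map_iff: "g x \<in> orb \<longleftrightarrow> x \<in> orb"
proof
  assume "g x \<in> orb"
  define x' where "x' = (g ^^ (q - 1)) (g x) + of_int (- p)"
  have "x' \<in> orb" unfolding x'_def by (intro orb_shift orb_iter) fact
  have "g x' = (g ^^ q) (g x) + of_int (- p)"
    unfolding x'_def g.shift using q_pos by (cases q) auto
  also have "\<dots> = g x" using orb_periodic[OF \<open>g x \<in> orb\<close>] by simp
  finally have "x' = x" using g.strict by (metis linorder_neqE_linordered_idom less_irrefl)
  then show "x \<in> orb" using \<open>x' \<in> orb\<close> by simp
qed (rule orb_map)

text \<open>Up to integer translation the exponent matters only modulo \<open>q\<close>. The
  cardinality bound later shows that \<open>q\<close> consecutive gaps cover a unit length.\<close>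

lemma orb_unit_interval:
  "finite (orb \<inter> {x..<x + 1})" "card (orb \<inter> {x..<x + 1}) \<le> q"
proof -
  have sub: "orb \<inter> {x..<x + 1} \<subseteq> (\<lambda>j. x + frac ((g ^^ j) b - x)) ` {..<q}"
  proof
    fix w assume w: "w \<in> orb \<inter> {x..<x + 1}"
    then obtain j m where jm: "w = (g ^^ j) b + of_int m" unfolding orb_def by auto
    have "(g ^^ j) b = (g ^^ (j mod q)) ((g ^^ (q * (j div q))) b)"
      by (metis add.commute comp_apply funpow_add mult_div_mod_eq)
    also have "\<dots> = (g ^^ (j mod q)) b + of_int (int (j div q) * p)"
      by (simp only: orb_periodic_mult[OF break_in_orb] g.iter_shift)
    finally have "w - x = ((g ^^ (j mod q)) b - x) + of_int (int (j div q) * p + m)"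
      unfolding jm by simp
    moreover have "frac (a + of_int i) = frac a" for a :: real and i by (simp add: frac_def)
    ultimately have "frac (w - x) = frac ((g ^^ (j mod q)) b - x)" by (simp only:)
    moreover have "frac (w - x) = w - x" using w by (simp add: frac_eq)
    ultimately have "w = x + frac ((g ^^ (j mod q)) b - x)" by simp
    then show "w \<in> (\<lambda>j. x + frac ((g ^^ j) b - x)) ` {..<q}"
      using q_pos by (intro image_eqI[of _ _ "j mod q"]) auto
  qed
  then show "finite (orb \<inter> {x..<x + 1})" by (rule finite_subset) simp
  have "card (orb \<inter> {x..<x + 1}) \<le> card ((\<lambda>j. x + frac ((g ^^ j) b - x)) ` {..<q})"
    using sub by (intro card_mono) auto
  also have "\<dots> \<le> q" using card_image_le[of "{..<q}"] by (metis card_lessThan finite_lessThan)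
  finally show "card (orb \<inter> {x..<x + 1}) \<le> q" .
qed

lemma ex_gap_right:
  assumes "y \<in> orb"
  shows "\<exists>z. gap y z"
proof -
  let ?A = "orb \<inter> {y<..y + 1}"
  have "?A \<subseteq> insert (y + 1) (orb \<inter> {y..<y + 1})" by auto
  then have fin: "finite ?A" by (rule finite_subset) (simp add: orb_unit_interval(1))
  have ne: "?A \<noteq> {}" using orb_shift[OF assms, of 1] by auto
  define z where "z = Min ?A"
  have "z \<in> ?A" unfolding z_def by (rule Min_in[OF fin ne])
  moreover have "{y<..<z} \<inter> orb = {}"
  proof (rule ccontr)
    assume "{y<..<z} \<inter> orb \<noteq> {}"
    then obtain w where w: "w \<in> orb" "y < w" "w < z" by auto
    then have "w \<in> ?A" using \<open>z \<in> ?A\<close> by auto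
    then have "z \<le> w" unfolding z_def using fin by (rule Min_le[rotated])
    then show False using w by simp
  qed
  ultimately show ?thesis unfolding gap_def using assms by auto
qed

lemma ex_gap_around:
  assumes "x \<notin> orb"
  shows "\<exists>y z. gap y z \<and> y < x \<and> x < z"
proof -
  let ?A = "orb \<inter> {x - 1..<x}"
  have fin: "finite ?A" using orb_unit_interval(1)[of "x - 1"] by simp
  \<comment> \<open>This is the largest translate of \<open>b\<close> that does not exceed
    \<open>x\<close>; it differs from \<open>x\<close> because \<open>x\<close> is off the
    orbit.\<close>
  have "b + of_int (- \<lceil>b - x\<rceil> - 1 + 1) \<in> orb" by (rule orb_shift[OF break_in_orb])
  moreover have "b + of_int (- \<lceil>b - x\<rceil> - 1 + 1) \<le> x" "x - 1 \<le> b + of_int (- \<lceil>b - x\<rceil> - 1 + 1)"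
    by (simp; linarith)+
  ultimately have ne: "?A \<noteq> {}" using assms
    by (metis (no_types, lifting) IntI atLeastLessThan_iff empty_iff order_le_imp_less_or_eq)
  define y where "y = Max ?A"
  have y: "y \<in> ?A" unfolding y_def by (rule Max_in[OF fin ne])
  obtain z where z: "gap y z" using ex_gap_right[of y] y by auto
  have "x < z"
  proof (rule ccontr)
    assume "\<not> x < z"
    then have "z \<in> ?A" using z y assms unfolding gap_def by force
    then have "z \<le> y" unfolding y_def using fin by (rule Max_ge[rotated])
    then show False using z unfolding gap_def by simp
  qed
  then show ?thesis using z y by auto
qed

lemma gap_unique_around:
  "gap y z \<Longrightarrow> gap y' z' \<Longrightarrow> y < x \<Longrightarrow> x < z \<Longrightarrow> y' < x \<Longrightarrow> x < z' \<Longrightarrow> y = y' \<and> z = z'"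
  unfolding gap_def disjoint_iff greaterThanLessThan_iff
  by (metis less_trans linorder_neqE_linordered_idom)

lemma gap_right_unique: "gap y z \<Longrightarrow> gap y z' \<Longrightarrow> z = z'"
  unfolding gap_def disjoint_iff greaterThanLessThan_iff
  by (metis linorder_neqE_linordered_idom)

lemma gap_shift: "gap y z \<Longrightarrow> gap (y + of_int m) (z + of_int m)"
  unfolding gap_def disjoint_iff greaterThanLessThan_iff
  by (smt (verit) orb_shift orb_shift[of _ "- m"] of_int_minus)

text \<open>An orbit point inside the image would have an orbit preimage inside the gap.\<close>

lemma gap_map:
  assumes "gap y z" shows "gap (g y) (g z)"
proof -
  have "{g y<..<g z} \<inter> orb = {}"
  proof (rule ccontr)
    assume "{g y<..<g z} \<inter> orb \<noteq> {}"
    then obtain w where w: "w \<in> orb" "g y < w" "w < g z" by auto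
    define x where "x = (g ^^ (q - 1)) w + of_int (- p)"
    have "g x = (g ^^ q) w + of_int (- p)"
      unfolding x_def g.shift using q_pos by (cases q) auto
    then have gx: "g x = w" using orb_periodic[OF w(1)] by simp
    then have "x \<in> orb" using w(1) orb_map_iff by metis
    moreover have "y < x" "x < z"
      using w(2,3) g.strict unfolding gx[symmetric] by (metis linorder_neqE_linordered_idom less_asym)+
    ultimately show False using assms unfolding gap_def by auto
  qed
  then show ?thesis using assms orb_map g.strict unfolding gap_def by auto
qed

lemma gap_iter: "gap y z \<Longrightarrow> gap ((g ^^ n) y) ((g ^^ n) z)"
  by (induction n) (auto simp: gap_map)

lemma gap_length_le: "gap y z \<Longrightarrow> z - y \<le> 1"
  using orb_shift[of y 1] unfolding gap_def disjoint_iff greaterThanLessThan_iff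
  by (smt (verit) of_int_1)

text \<open>The interior of a gap never meets a translate of \<^term>\<open>b\<close>, so only the integers matter.\<close>

lemma gap_affine:
  assumes gap: "gap y z" and noint: "\<And>n. \<not> (y < of_int n \<and> of_int n < z)"
  obtains \<sigma> where "\<sigma> = L \<or> \<sigma> = 1 / L" "\<And>w. y \<le> w \<Longrightarrow> w \<le> z \<Longrightarrow> g w = g y + \<sigma> * (w - y)"
proof -
  have "\<not> (y < b + of_int n \<and> b + of_int n < z)" for n
    using gap orb_shift[OF break_in_orb, of n] unfolding gap_def by auto
  moreover have "y < z" using gap unfolding gap_def by simp
  ultimately obtain \<sigma> where \<sigma>: "\<sigma> = L \<or> \<sigma> = 1 / L"
    "\<And>w. y \<le> w \<Longrightarrow> w \<le> z \<Longrightarrow> pl_lift L w = pl_lift L y + \<sigma> * (w - y)"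
    using pl_lift_affine[OF L, of y z] noint by metis
  have "g w = g y + \<sigma> * (w - y)" if "y \<le> w" "w \<le> z" for w
    using \<sigma>(2)[OF that] by (simp add: pl_family_def)
  then show thesis by (rule that[OF \<sigma>(1)])
qed

text \<open>Each affine step changes the exponent of \<open>L\<close> by 1 in one direction or the
  other, so its parity is that of the number of steps.\<close>

lemma gap_iter_length:
  assumes gap: "gap y z"
    and noint: "\<And>i n. i < j \<Longrightarrow> \<not> ((g ^^ i) y < of_int n \<and> of_int n < (g ^^ i) z)"
  shows "\<exists>e. even (e + int j) \<and> (g ^^ j) z - (g ^^ j) y = L powi e * (z - y)"
  using noint
proof (induction j)
  case 0
  show ?case by (intro exI[of _ 0]) simp
next
  case (Suc j)
  then obtain e where e: "even (e + int j)" "(g ^^ j) z - (g ^^ j) y = L powi e * (z - y)"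
    by auto
  obtain \<sigma> where \<sigma>: "\<sigma> = L \<or> \<sigma> = 1 / L"
    "\<And>w. (g ^^ j) y \<le> w \<Longrightarrow> w \<le> (g ^^ j) z \<Longrightarrow> g w = g ((g ^^ j) y) + \<sigma> * (w - (g ^^ j) y)"
    using gap_affine[OF gap_iter[OF gap, of j]] Suc.prems[of j] by auto
  have len: "(g ^^ Suc j) z - (g ^^ Suc j) y = \<sigma> * (L powi e * (z - y))"
    using \<sigma>(2)[of "(g ^^ j) z"] gap_iter[OF gap, of j] e unfolding gap_def by simp
  from \<sigma>(1) show ?case
  proof
    assume "\<sigma> = L"
    then show ?thesis using len L e(1)
      by (intro exI[of _ "e + 1"]) (auto simp: power_int_add)
  next
    assume "\<sigma> = 1 / L"
    then show ?thesis using len L e(1)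
      by (intro exI[of _ "e - 1"]) (auto simp: power_int_diff)
  qed
qed

lemma powi_eq_1_iff: "L powi e = 1 \<longleftrightarrow> e = 0"
  using L power_int_strict_increasing[of 0 e L] power_int_strict_increasing[of e 0 L]
  by (cases e "0::int" rule: linorder_cases) auto

text \<open>If an integer were on the orbit of \<^term>\<open>b\<close>, then \<open>g ^^ q\<close> would be affine on every gap with
  slope an odd power of \<open>L\<close>, although it maps the gap to a translate of itself.\<close>

lemma int_not_in_orb: "of_int n \<notin> orb"
proof
  assume n: "of_int n \<in> orb"
  then have "of_int n + of_int (m - n) \<in> orb" for m by (rule orb_shift)
  then have all: "of_int m \<in> orb" for m by simp
  obtain z where z: "gap b z" using ex_gap_right[OF break_in_orb] by auto
  obtain e where e: "even (e + int q)" "(g ^^ q) z - (g ^^ q) b = L powi e * (z - b)"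
  proof -
    have "\<not> ((g ^^ i) b < of_int m \<and> of_int m < (g ^^ i) z)" for i m
      using gap_iter[OF z, of i] all[of m] unfolding gap_def by auto
    from gap_iter_length[OF z this, of q] show thesis using that by auto
  qed
  have "(g ^^ q) z - (g ^^ q) b = z - b" using z orb_periodic unfolding gap_def by simp
  then have "L powi e = 1" using e z unfolding gap_def by simp
  then show False using powi_eq_1_iff e oddq by auto
qed

section \<open>The cycle of gaps starting at the gap around 0\<close>

definition lgap :: real where "lgap = (SOME y. \<exists>z. gap y z \<and> y < 0 \<and> 0 < z)"
definition rgap :: real where "rgap = (SOME z. gap lgap z \<and> lgap < 0 \<and> 0 < z)"

lemma gap0: "gap lgap rgap" "lgap < 0" "0 < rgap"
proof -
  have "\<exists>y z. gap y z \<and> y < 0 \<and> 0 < z" using ex_gap_around int_not_in_orb[of 0] by simp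
  then have "\<exists>z. gap lgap z \<and> lgap < 0 \<and> 0 < z" unfolding lgap_def by (rule someI_ex)
  then have "gap lgap rgap \<and> lgap < 0 \<and> 0 < rgap" unfolding rgap_def by (rule someI_ex)
  then show "gap lgap rgap" "lgap < 0" "0 < rgap" by auto
qed

text \<open>Indices below \<open>q\<close> represent every gap up to integer translation, and only
  index 0 among them has an integer inside.\<close>

definition lpt :: "nat \<Rightarrow> real" where "lpt j = (g ^^ j) lgap"
definition rpt :: "nat \<Rightarrow> real" where "rpt j = (g ^^ j) rgap"
definition len :: "nat \<Rightarrow> real" where "len j = rpt j - lpt j"

lemma gap_pt: "gap (lpt j) (rpt j)"
  unfolding lpt_def rpt_def using gap0 gap_iter by auto

lemma len_pos: "0 < len j" and len_le: "len j \<le> 1"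
  using gap_pt[of j] gap_length_le[of "lpt j" "rpt j"] unfolding len_def gap_def by auto

lemma pt_q: "lpt q = lgap + of_int p" "rpt q = rgap + of_int p"
  using gap0 orb_periodic unfolding lpt_def rpt_def gap_def by auto

text \<open>Repeat the return \<open>q\<close> times and the period \<open>j\<close> times: both
  describe the iterate of order \<open>j * q\<close>, so \<open>q * m = j * p\<close>, and
  coprimality applies.\<close>

lemma lpt_returns:
  assumes "lpt j = lgap + of_int m"
  shows "q dvd j"
proof -
  have y: "lgap \<in> orb" using gap0 unfolding gap_def by simp
  have it: "(g ^^ (j * n)) lgap = lgap + of_int (int n * m)" for n
  proof (induction n)
    case (Suc n)
    have "(g ^^ (j * Suc n)) lgap = (g ^^ j) ((g ^^ (j * n)) lgap)" by (simp add: funpow_add)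
    also have "\<dots> = (g ^^ j) lgap + of_int (int n * m)" unfolding Suc by (rule g.iter_shift)
    finally show ?case using assms by (simp add: lpt_def algebra_simps)
  qed simp
  have "real_of_int (int q * m) = of_int (int j * p)"
    using it[of q] orb_periodic_mult[OF y, of j] by (simp add: mult.commute)
  then have "int q * m = int j * p" by linarith
  then have "int q dvd int j"
    using coprime by (metis coprime_commute coprime_dvd_mult_left_iff dvd_triv_left)
  then show ?thesis by simp
qed

text \<open>An integer inside would make this gap a translate of the gap around 0, that is, a return
  before time \<open>q\<close>.\<close>

lemma no_int_in_gap:
  assumes "0 < j" "j < q"
  shows "\<not> (lpt j < of_int n \<and> of_int n < rpt j)"
proof
  assume *: "lpt j < of_int n \<and> of_int n < rpt j"
  have "gap (lpt j + of_int (- n)) (rpt j + of_int (- n))" by (rule gap_shift[OF gap_pt])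
  from gap_unique_around[OF this gap0(1), of 0] * gap0
  have "lpt j = lgap + of_int n" by simp
  then have "q dvd j" by (rule lpt_returns)
  then show False using assms by (auto dest: dvd_imp_le)
qed

text \<open>In coordinates relative to the gaps, \<open>g\<close> acts as the identity away from the
  gap around 0. Hence a parameter shift shows up as a pure drift in these coordinates.\<close>

lemma step_affine:
  assumes "0 < j" "j < q" "0 \<le> e" "e \<le> 1"
  shows "g (lpt j + e * len j) = lpt (Suc j) + e * len (Suc j)"
proof -
  obtain \<sigma> where \<sigma>: "\<And>w. lpt j \<le> w \<Longrightarrow> w \<le> rpt j \<Longrightarrow> g w = g (lpt j) + \<sigma> * (w - lpt j)"
    using gap_affine[OF gap_pt[of j]] no_int_in_gap[OF assms(1,2)] by metis
  have "rpt (Suc j) = lpt (Suc j) + \<sigma> * len j"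
    using \<sigma>[of "rpt j"] len_pos[of j] unfolding len_def by (simp add: lpt_def rpt_def)
  then have s: "len (Suc j) = \<sigma> * len j" by (simp add: len_def)
  have "e * len j \<le> len j" "0 \<le> e * len j"
    using assms len_pos[of j] mult_right_mono[of e 1 "len j"] by auto
  then have "g (lpt j + e * len j) = g (lpt j) + \<sigma> * (e * len j)"
    by (subst \<sigma>) (auto simp: len_def)
  then show ?thesis using s by (simp add: lpt_def)
qed

text \<open>The orbit points \<open>b - 1\<close> and \<open>b\<close> enclose the gap around 0, so
  each of its ends lies on a known branch.\<close>

lemma pl_lift_gap_ends: "pl_lift L rgap = L * rgap" "pl_lift L lgap = lgap / L"
proof -
  have "rgap \<le> b" "b - 1 \<le> lgap"
    using gap0 break_in_orb orb_shift[OF break_in_orb, of "- 1"] pl_break_bounds[OF L]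
    unfolding gap_def disjoint_iff greaterThanLessThan_iff by (smt (verit) of_int_minus of_int_1)+
  then show "pl_lift L rgap = L * rgap" "pl_lift L lgap = lgap / L"
    using pl_lift_left[OF L, of 0 rgap] pl_lift_right[OF L, of "-1" lgap] gap0 by auto
qed

lemma len_1: "len 1 = L * rgap - lgap / L"
  by (simp add: len_def lpt_def rpt_def pl_family_def pl_lift_gap_ends)

text \<open>Going once around, the gap is stretched by an even power of \<open>L\<close> outside the first step, and by
  a factor strictly between \<open>1 / L\<close> and \<open>L\<close> in the first step; hence both factors are 1.\<close>

lemma lgap_eq: "lgap = - L * rgap"
proof -
  have "\<exists>e. even (e + int (q - 1)) \<and> (g ^^ (q - 1)) (rpt 1) - (g ^^ (q - 1)) (lpt 1) = L powi e * (rpt 1 - lpt 1)"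
  proof (rule gap_iter_length[OF gap_pt])
    fix i n assume "i < q - 1"
    have "(g ^^ i) (lpt 1) = lpt (Suc i)" "(g ^^ i) (rpt 1) = rpt (Suc i)"
      unfolding lpt_def rpt_def by (simp_all add: funpow_swap1)
    then show "\<not> ((g ^^ i) (lpt 1) < of_int n \<and> of_int n < (g ^^ i) (rpt 1))"
      using no_int_in_gap[of "Suc i" n] \<open>i < q - 1\<close> by simp
  qed
  then obtain e where e: "even (e + int (q - 1))"
    "(g ^^ (q - 1)) (rpt 1) - (g ^^ (q - 1)) (lpt 1) = L powi e * len 1"
    unfolding len_def by auto
  have "(g ^^ (q - 1)) (lpt 1) = lpt q" "(g ^^ (q - 1)) (rpt 1) = rpt q"
    unfolding lpt_def rpt_def using q_pos by (cases q; simp add: funpow_swap1)+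
  then have len: "rgap - lgap = L powi e * len 1" using e(2) pt_q by simp
  have "even e" using e(1) oddq by (simp add: even_add q_pos Suc_leI of_nat_diff)
  have iL: "1 / L < 1" using L by simp
  have up: "len 1 < L * (rgap - lgap)"
  proof -
    have "- lgap * (1 / L) < - lgap * L" using gap0 L iL by (intro mult_strict_left_mono) linarith+
    then show ?thesis unfolding len_1 by (simp add: algebra_simps)
  qed
  have lo: "rgap - lgap < L * len 1"
  proof -
    have "1 * rgap < (L * L) * rgap" using gap0 L mult_strict_mono[of 1 L 1 L]
      by (intro mult_strict_right_mono) auto
    moreover have "L * len 1 = L * L * rgap - lgap" unfolding len_1 using L by (simp add: field_simps)
    ultimately show ?thesis by simp
  qed
  have "L powi e < L powi 1"
    using lo len_pos[of 1] unfolding len by simp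
  then have "e < 1" using L power_int_increasing[of 1 e L] by (metis less_le_not_le linorder_not_le)
  moreover have "L powi (-1) < L powi e"
  proof -
    have "len 1 < (L * L powi e) * len 1" using up unfolding len by (simp add: algebra_simps)
    then have "1 < L * L powi e" using len_pos[of 1] by simp
    then show ?thesis using L by (simp add: power_int_minus field_simps)
  qed
  then have "-1 < e" using L power_int_increasing[of e "-1" L] by (metis less_le_not_le linorder_not_le)
  ultimately have "e = 0" using \<open>even e\<close> by presburger
  then have "rgap - lgap = L * rgap - lgap / L" using len len_1 by simp
  moreover have "(L - 1) * (rgap + lgap / L) = L * (rgap + lgap / L) - (rgap + lgap / L)"
    by (simp add: left_diff_distrib)
  moreover have "L * (rgap + lgap / L) = L * rgap + lgap" using L by (simp add: distrib_left)
  ultimately have "(L - 1) * (rgap + lgap / L) = 0" by linarith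
  then have "lgap / L = - rgap" using L by simp
  then show ?thesis using L by (simp add: field_simps)
qed

text \<open>Relative drift per unit of parameter shift over the steps from time \<open>i\<close> to
  time \<open>j\<close>. The left end is excluded because each step's shift is measured in the gap
  where it arrives.\<close>

definition recip_sum :: "nat \<Rightarrow> nat \<Rightarrow> real" where
  "recip_sum i j = (\<Sum>k\<in>{i<..j}. 1 / len k)"

lemma recip_sum_self [simp]: "recip_sum i i = 0"
  by (simp add: recip_sum_def)

lemma recip_sum_Suc: "i \<le> j \<Longrightarrow> recip_sum i (Suc j) = recip_sum i j + 1 / len (Suc j)"
proof -
  assume "i \<le> j"
  then have "{i<..Suc j} = insert (Suc j) {i<..j}" by auto
  then show ?thesis by (simp add: recip_sum_def)
qed

lemma recip_sum_nonneg: "0 \<le> recip_sum i j"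
  unfolding recip_sum_def using len_pos by (intro sum_nonneg) (simp add: less_imp_le)

lemma recip_sum_split: "i \<le> j \<Longrightarrow> recip_sum 0 j = recip_sum 0 i + recip_sum i j"
proof (induction j rule: dec_induct)
  case (step j)
  then show ?case by (simp add: recip_sum_Suc)
qed simp

text \<open>Gaps have length at most 1. This bound makes the parameter intervals of size
  \<open>2 / recip_sum 0 q\<close> shrink as \<open>q\<close> grows.\<close>

lemma recip_sum_ge: "real q \<le> recip_sum 0 q"
proof -
  have "(\<Sum>k\<in>{0<..q}. 1) \<le> recip_sum 0 q"
    unfolding recip_sum_def using len_pos len_le by (intro sum_mono) simp
  then show ?thesis by simp
qed

end

section \<open>Rotation numbers near the parameter of a periodic break point\<close>

context periodic_break
begin

lemma pl_family_add: "pl_family L (\<tau> + s) x = g x + s"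
  by (simp add: pl_family_def)

lemma family_iter_ge:
  assumes "0 \<le> s" shows "(g ^^ n) x \<le> (pl_family L (\<tau> + s) ^^ n) x"
proof (induction n)
  case (Suc n)
  have "g ((g ^^ n) x) \<le> g ((pl_family L (\<tau> + s) ^^ n) x)"
    using g.iter_mono[OF Suc, of 1] by simp
  then show ?case using assms pl_family_add[of s "(pl_family L (\<tau> + s) ^^ n) x"] by simp
qed simp

lemma family_iter_le:
  assumes "s \<le> 0" shows "(pl_family L (\<tau> + s) ^^ n) x \<le> (g ^^ n) x"
proof (induction n)
  case (Suc n)
  have "g ((pl_family L (\<tau> + s) ^^ n) x) \<le> g ((g ^^ n) x)"
    using g.iter_mono[OF Suc, of 1] by simp
  then show ?case using assms pl_family_add[of s "(pl_family L (\<tau> + s) ^^ n) x"] by simp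
qed simp

text \<open>From below, the orbit of \<open>b\<close> can only move ahead when the parameter
  increases. From above, follow the orbit of 0: its drift is too small to carry it past the
  translate of 0 by \<open>p\<close>.\<close>

lemma translation_number_plateau:
  assumes s: "0 \<le> s" "s * recip_sum 0 q \<le> (L - 1) / (L + 1)"
  shows "translation_number (pl_family L (\<tau> + s)) = of_int p / real q"
proof -
  let ?v = "pl_family L (\<tau> + s)"
  interpret v: circle_lift ?v by (rule circle_lift_pl_family[OF L])
  \<comment> \<open>By \<open>lgap_eq\<close>, \<open>c\<close> is the relative position of
    \<open>g 0\<close> in the gap of index 1, and \<open>L * c\<close> that of 0 in its own gap. The
    admissible drift is their difference \<open>(L - 1) / (L + 1)\<close>.\<close>
  define c where "c = 1 / (1 + L)"
  have c: "0 < c" "c * (1 + L) = 1" "c + (L - 1) / (L + 1) = L * c"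
    using L by (auto simp: c_def field_simps)
  have Lc: "L * c \<le> 1" using c L by (simp add: algebra_simps)
  have lr: "lgap = - L * rgap" by (rule lgap_eq)
  have l1: "len 1 = (1 + L) * rgap" using len_1 L lr by (simp add: algebra_simps)
  have lq: "len q = (1 + L) * rgap" using pt_q lr by (simp add: len_def algebra_simps)
  have lpt1: "lpt 1 = \<tau> - rgap"
    using pl_lift_gap_ends(2) lr L by (simp add: lpt_def pl_family_def)
  have bound: "(?v ^^ j) 0 \<le> lpt j + (c + s * recip_sum 0 j) * len j" if "1 \<le> j" "j \<le> q" for j
    using that
  proof (induction j rule: nat_induct_at_least)
    case base
    have "(c + s * recip_sum 0 1) * len 1 = c * len 1 + s * (recip_sum 0 1 * len 1)"
      by (simp add: algebra_simps)
    also have "c * len 1 = c * (1 + L) * rgap" unfolding l1 by simp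
    also have "recip_sum 0 1 * len 1 = 1" using recip_sum_Suc[of 0 0] len_pos[of 1] by simp
    finally show ?case using c lpt1 pl_lift_int[OF L, of 0] by (simp add: pl_family_def)
  next
    case (Suc j)
    define e where "e = c + s * recip_sum 0 j"
    have "recip_sum 0 j \<le> recip_sum 0 q"
      using recip_sum_split[of j q] recip_sum_nonneg[of j q] Suc.prems by simp
    then have "s * recip_sum 0 j \<le> (L - 1) / (L + 1)"
      using s mult_left_mono[of "recip_sum 0 j" "recip_sum 0 q" s] by linarith
    then have e: "0 \<le> e" "e \<le> 1"
      using c Lc s recip_sum_nonneg[of 0 j] unfolding e_def by auto
    have "(?v ^^ Suc j) 0 \<le> ?v (lpt j + e * len j)"
      using v.iter_mono[of "(?v ^^ j) 0" "lpt j + e * len j" 1] Suc unfolding e_def by simp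
    also have "\<dots> = lpt (Suc j) + e * len (Suc j) + s"
      using step_affine[of j e] Suc e by (simp add: pl_family_add)
    also have "\<dots> = lpt (Suc j) + (c + s * recip_sum 0 (Suc j)) * len (Suc j)"
      using len_pos[of "Suc j"] unfolding e_def by (simp add: recip_sum_Suc field_simps)
    finally show ?case .
  qed
  have "(?v ^^ q) 0 \<le> lpt q + (c + s * recip_sum 0 q) * len q"
    using bound[of q] q_pos by simp
  also have "\<dots> \<le> lpt q + (L * c) * len q"
    using s c len_pos[of q] by (intro add_left_mono mult_right_mono) auto
  also have "(L * c) * len q = L * rgap" using c(2) by (simp add: lq mult.assoc[symmetric])
  also have "lpt q + L * rgap = 0 + of_int p" using pt_q lr by simp
  finally have "translation_number ?v \<le> of_int p / real q" using v.translation_number_le[OF q_pos] by blast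
  moreover have "b + of_int p \<le> (?v ^^ q) b" using family_iter_ge[OF s(1), of q b] periodic by simp
  then have "translation_number ?v \<ge> of_int p / real q" by (rule v.translation_number_ge[OF q_pos])
  ultimately show ?thesis by simp
qed

text \<open>The relative position gains at least \<open>s / len k\<close> on entering gap
  \<open>k\<close>. Capping it at 1 keeps the comparison point in the closed gap, where
  \<open>step_affine\<close> applies.\<close>

lemma run_right:
  assumes s: "0 \<le> s" and ij: "i \<le> j" "j \<le> q"
  shows "lpt j + min 1 (s * recip_sum i j) * len j \<le> (pl_family L (\<tau> + s) ^^ (j - i)) (lpt i)"
  using ij
proof (induction j rule: dec_induct)
  case (step j)
  let ?v = "pl_family L (\<tau> + s)"
  interpret v: circle_lift ?v by (rule circle_lift_pl_family[OF L])
  define e where "e = min 1 (s * recip_sum i j)"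
  have e: "0 \<le> e" "e \<le> 1" using s recip_sum_nonneg[of i j] unfolding e_def by auto
  have ge: "g (lpt j + e * len j) = lpt (Suc j) + e * len (Suc j)"
  \<comment> \<open>The gap around 0 is left only in the very first step from \<open>i = 0\<close>,
    when the drift is still 0 and affinity is not at stake.\<close>
  proof (cases "j = 0")
    case True
    then show ?thesis using step by (simp add: e_def lpt_def)
  next
    case False
    then show ?thesis using step e by (intro step_affine) auto
  qed
  have "s * recip_sum i (Suc j) = s * recip_sum i j + s / len (Suc j)"
    using step by (simp add: recip_sum_Suc algebra_simps)
  moreover have "0 \<le> s / len (Suc j)" using s len_pos[of "Suc j"] by simp
  ultimately have "min 1 (s * recip_sum i (Suc j)) \<le> e + s / len (Suc j)"
    unfolding e_def by linarith
  then have "min 1 (s * recip_sum i (Suc j)) * len (Suc j) \<le> (e + s / len (Suc j)) * len (Suc j)"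
    using len_pos[of "Suc j"] by (intro mult_right_mono) auto
  also have "\<dots> = e * len (Suc j) + s" using len_pos[of "Suc j"] by (simp add: field_simps)
  finally have "lpt (Suc j) + min 1 (s * recip_sum i (Suc j)) * len (Suc j) \<le> ?v (lpt j + e * len j)"
    using ge by (simp add: pl_family_add)
  also have "\<dots> \<le> ?v ((?v ^^ (j - i)) (lpt i))"
    using v.iter_mono[of "lpt j + e * len j" "(?v ^^ (j - i)) (lpt i)" 1] step unfolding e_def by simp
  also have "\<dots> = (?v ^^ (Suc j - i)) (lpt i)" using step by (simp add: Suc_diff_le)
  finally show ?case .
qed simp

lemma run_left:
  assumes s: "0 \<le> s" and ij: "i \<le> j" "j \<le> q"
  shows "(pl_family L (\<tau> - s) ^^ (j - i)) (rpt i) \<le> rpt j - min 1 (s * recip_sum i j) * len j"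
  using ij
proof (induction j rule: dec_induct)
  case (step j)
  let ?v = "pl_family L (\<tau> - s)"
  interpret v: circle_lift ?v by (rule circle_lift_pl_family[OF L])
  define e where "e = min 1 (s * recip_sum i j)"
  have e: "0 \<le> e" "e \<le> 1" using s recip_sum_nonneg[of i j] unfolding e_def by auto
  have ge: "g (rpt j - e * len j) = rpt (Suc j) - e * len (Suc j)"
  proof (cases "j = 0")
    case True
    then show ?thesis using step by (simp add: e_def rpt_def)
  next
    case False
    have "rpt k - e * len k = lpt k + (1 - e) * len k" for k by (simp add: len_def algebra_simps)
    then show ?thesis using step e False step_affine[of j "1 - e"] by simp
  qed
  have "s * recip_sum i (Suc j) = s * recip_sum i j + s / len (Suc j)"
    using step by (simp add: recip_sum_Suc algebra_simps)
  moreover have "0 \<le> s / len (Suc j)" using s len_pos[of "Suc j"] by simp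
  ultimately have "min 1 (s * recip_sum i (Suc j)) \<le> e + s / len (Suc j)"
    unfolding e_def by linarith
  then have "min 1 (s * recip_sum i (Suc j)) * len (Suc j) \<le> (e + s / len (Suc j)) * len (Suc j)"
    using len_pos[of "Suc j"] by (intro mult_right_mono) auto
  also have "\<dots> = e * len (Suc j) + s" using len_pos[of "Suc j"] by (simp add: field_simps)
  finally have *: "?v (rpt j - e * len j) \<le> rpt (Suc j) - min 1 (s * recip_sum i (Suc j)) * len (Suc j)"
    using ge pl_family_add[of "- s"] by simp
  have "(?v ^^ (Suc j - i)) (rpt i) = ?v ((?v ^^ (j - i)) (rpt i))" using step by (simp add: Suc_diff_le)
  also have "\<dots> \<le> ?v (rpt j - e * len j)"
    using v.iter_mono[of "(?v ^^ (j - i)) (rpt i)" "rpt j - e * len j" 1] step unfolding e_def by simp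
  finally show ?case using * by simp
qed simp

text \<open>Starting in gap \<open>i\<close>, the run is cut where it reaches the gap around 0,
  since relative positions are not carried through that gap. The constant 2 guarantees a full
  crossing in one of the two pieces.\<close>

lemma recip_sum_half:
  assumes "2 \<le> s * recip_sum 0 q" "i \<le> q"
  shows "1 \<le> s * recip_sum i q \<or> 1 \<le> s * recip_sum 0 i"
  using assms by (simp add: recip_sum_split[of i q] algebra_simps) linarith

text \<open>One piece of the run crosses a whole gap; in the other piece, monotonicity in the
  parameter ensures that nothing is lost.\<close>

lemma cross_right:
  assumes s: "0 \<le> s" "2 \<le> s * recip_sum 0 q" and i: "i \<le> q"
  shows "rpt i + of_int p \<le> (pl_family L (\<tau> + s) ^^ q) (lpt i)"
proof -
  let ?v = "pl_family L (\<tau> + s)"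
  interpret v: circle_lift ?v by (rule circle_lift_pl_family[OF L])
  have split: "(?v ^^ q) x = (?v ^^ i) ((?v ^^ (q - i)) x)" for x
    using i by (metis comp_apply funpow_add le_add_diff_inverse)
  from recip_sum_half[OF s(2) i] show ?thesis
  proof
    assume "1 \<le> s * recip_sum i q"
    then have "rpt 0 + of_int p \<le> (?v ^^ (q - i)) (lpt i)"
      using run_right[OF s(1) i order_refl] pt_q by (simp add: len_def rpt_def)
    then have "(?v ^^ i) (rpt 0 + of_int p) \<le> (?v ^^ q) (lpt i)"
      unfolding split by (rule v.iter_mono)
    moreover have "rpt i \<le> (?v ^^ i) (rpt 0)" using family_iter_ge[OF s(1), of i rgap] by (simp add: rpt_def)
    ultimately show ?thesis unfolding v.iter_shift by linarith
  next
    assume "1 \<le> s * recip_sum 0 i"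
    then have 1: "rpt i \<le> (?v ^^ i) (lpt 0)"
      using run_right[OF s(1) le0 i] by (simp add: len_def)
    have "(g ^^ (q - i)) (lpt i) = lpt q"
      using i unfolding lpt_def by (metis comp_apply funpow_add le_add_diff_inverse2)
    then have "lpt 0 + of_int p \<le> (?v ^^ (q - i)) (lpt i)"
      using family_iter_ge[OF s(1), of "q - i" "lpt i"] pt_q by (simp add: lpt_def)
    then have "(?v ^^ i) (lpt 0 + of_int p) \<le> (?v ^^ q) (lpt i)"
      unfolding split by (rule v.iter_mono)
    then show ?thesis using 1 unfolding v.iter_shift by linarith
  qed
qed

lemma cross_left:
  assumes s: "0 \<le> s" "2 \<le> s * recip_sum 0 q" and i: "i \<le> q"
  shows "(pl_family L (\<tau> - s) ^^ q) (rpt i) \<le> lpt i + of_int p"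
proof -
  let ?v = "pl_family L (\<tau> - s)"
  interpret v: circle_lift ?v by (rule circle_lift_pl_family[OF L])
  have split: "(?v ^^ q) x = (?v ^^ i) ((?v ^^ (q - i)) x)" for x
    using i by (metis comp_apply funpow_add le_add_diff_inverse)
  have le: "(?v ^^ n) x \<le> (g ^^ n) x" for n x
    using family_iter_le[of "- s" n x] s by simp
  from recip_sum_half[OF s(2) i] show ?thesis
  proof
    assume "1 \<le> s * recip_sum i q"
    then have "(?v ^^ (q - i)) (rpt i) \<le> lpt 0 + of_int p"
      using run_left[OF s(1) i order_refl] pt_q by (simp add: len_def lpt_def)
    then have "(?v ^^ q) (rpt i) \<le> (?v ^^ i) (lpt 0 + of_int p)"
      unfolding split by (rule v.iter_mono)
    moreover have "(?v ^^ i) (lpt 0) \<le> lpt i" using le[of i lgap] by (simp add: lpt_def)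
    ultimately show ?thesis unfolding v.iter_shift by linarith
  next
    assume "1 \<le> s * recip_sum 0 i"
    then have 1: "(?v ^^ i) (rpt 0) \<le> lpt i"
      using run_left[OF s(1) le0 i] by (simp add: len_def)
    have "(g ^^ (q - i)) (rpt i) = rpt q"
      using i unfolding rpt_def by (metis comp_apply funpow_add le_add_diff_inverse2)
    then have "(?v ^^ (q - i)) (rpt i) \<le> rpt 0 + of_int p"
      using le[of "q - i" "rpt i"] pt_q by (simp add: rpt_def)
    then have "(?v ^^ q) (rpt i) \<le> (?v ^^ i) (rpt 0 + of_int p)"
      unfolding split by (rule v.iter_mono)
    then show ?thesis using 1 unfolding v.iter_shift by linarith
  qed
qed

section \<open>Gaining one gap per period far from the central parameter\<close>

lemma gap_is_translate:
  assumes "gap y z"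
  obtains i m where "i \<le> q" "y = lpt i + of_int m" "z = rpt i + of_int m"
proof -
  obtain j m where y: "y = (g ^^ j) b + of_int m" using assms unfolding gap_def orb_def by auto
  obtain k m' where l: "lgap = (g ^^ k) b + of_int m'" using gap0(1) unfolding gap_def orb_def by auto
  \<comment> \<open>Going back \<open>k\<close> steps along the orbit is replaced by going forward
    \<open>(q - 1) * k\<close> steps, which agrees up to an integer translation.\<close>
  define n where "n = j + (q - 1) * k"
  have "n + k = j + q * k" using q_pos unfolding n_def by (cases q) auto
  then have "(g ^^ n) ((g ^^ k) b) = (g ^^ j) ((g ^^ (q * k)) b)" by (metis comp_apply funpow_add)
  also have "\<dots> = (g ^^ j) b + of_int (int k * p)"
    unfolding orb_periodic_mult[OF break_in_orb] by (rule g.iter_shift)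
  finally have 1: "lpt n = (g ^^ j) b + of_int (int k * p + m')"
    unfolding lpt_def l g.iter_shift by simp
  define i where "i = n mod q"
  have "lpt n = (g ^^ i) ((g ^^ (q * (n div q))) lgap)"
    unfolding lpt_def i_def by (metis add.commute comp_apply funpow_add mult_div_mod_eq)
  also have "\<dots> = (g ^^ i) (lgap + of_int (int (n div q) * p))"
    using orb_periodic_mult[of lgap "n div q"] gap0(1) unfolding gap_def by simp
  also have "\<dots> = lpt i + of_int (int (n div q) * p)" unfolding lpt_def by (rule g.iter_shift)
  finally have 2: "y = lpt i + of_int (m + int (n div q) * p - int k * p - m')"
    using 1 y by simp
  have "gap y (rpt i + of_int (m + int (n div q) * p - int k * p - m'))"
    unfolding 2 by (rule gap_shift[OF gap_pt])
  then have "z = rpt i + of_int (m + int (n div q) * p - int k * p - m')"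
    using assms gap_right_unique by blast
  moreover have "i \<le> q" using q_pos unfolding i_def by (simp add: less_imp_le)
  ultimately show thesis using that 2 by blast
qed

lemma gap_cross_right:
  assumes "0 \<le> s" "2 \<le> s * recip_sum 0 q" "gap y z"
  shows "z + of_int p \<le> (pl_family L (\<tau> + s) ^^ q) y"
proof -
  interpret v: circle_lift "pl_family L (\<tau> + s)" by (rule circle_lift_pl_family[OF L])
  obtain i m where i: "i \<le> q" and yz: "y = lpt i + of_int m" "z = rpt i + of_int m"
    using gap_is_translate[OF assms(3)] .
  show ?thesis using cross_right[OF assms(1,2) i] unfolding yz v.iter_shift by linarith
qed

lemma gap_cross_left:
  assumes "0 \<le> s" "2 \<le> s * recip_sum 0 q" "gap y z"
  shows "(pl_family L (\<tau> - s) ^^ q) z \<le> y + of_int p"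
proof -
  interpret v: circle_lift "pl_family L (\<tau> - s)" by (rule circle_lift_pl_family[OF L])
  obtain i m where i: "i \<le> q" and yz: "y = lpt i + of_int m" "z = rpt i + of_int m"
    using gap_is_translate[OF assms(3)] .
  show ?thesis using cross_left[OF assms(1,2) i] unfolding yz v.iter_shift by linarith
qed

text \<open>If \<open>q\<close> consecutive gaps did not fill a unit length, \<open>q + 1\<close>
  orbit points would lie in a half-open unit interval.\<close>

lemma ex_gap_chain:
  obtains x :: "nat \<Rightarrow> real"
  where "x 0 = b" "\<And>i. gap (x i) (x (Suc i))" "b + 1 \<le> x q"
proof -
  have "\<exists>x. \<forall>i. (x i \<in> orb \<and> (i = 0 \<longrightarrow> x i = b)) \<and> gap (x i) (x (Suc i))"
  proof (rule dependent_nat_choice)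
    show "\<exists>x. x \<in> orb \<and> (0 = (0::nat) \<longrightarrow> x = b)" using break_in_orb by auto
    show "\<exists>z. (z \<in> orb \<and> (Suc n = 0 \<longrightarrow> z = b)) \<and> gap y z"
      if "y \<in> orb \<and> (n = 0 \<longrightarrow> y = b)" for y n
      using ex_gap_right[of y] that unfolding gap_def by auto
  qed
  then obtain x where x: "x 0 = b" "\<And>i. x i \<in> orb" "\<And>i. gap (x i) (x (Suc i))" by blast
  have mono: "strict_mono x" using x(3) unfolding strict_mono_Suc_iff gap_def by blast
  have "b + 1 \<le> x q"
  proof (rule ccontr)
    assume *: "\<not> b + 1 \<le> x q"
    have "b \<le> x i \<and> x i \<le> x q" if "i \<le> q" for i
      using that strict_mono_less_eq[OF mono, of 0 i] strict_mono_less_eq[OF mono, of i q] x(1) by simp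
    then have "x ` {..q} \<subseteq> orb \<inter> {b..<b + 1}" using x(2) * by fastforce
    from card_mono[OF orb_unit_interval(1) this] have "card (x ` {..q}) \<le> q"
      using orb_unit_interval(2)[of b] by simp
    moreover have "card (x ` {..q}) = Suc q"
      using card_image[of x "{..q}"] strict_mono_imp_inj_on[OF mono] by (simp add: inj_on_subset)
    ultimately show False by simp
  qed
  then show thesis using that x by blast
qed

text \<open>Each block of \<open>q\<close> iterates gains one gap beyond \<open>p\<close>. After
  \<open>q\<close> blocks the gained gaps fill a unit, so \<open>q * q\<close> iterates advance
  \<open>b\<close> by at least \<open>q * p + 1\<close>.\<close>

lemma translation_number_far_right:
  assumes s: "0 \<le> s" "2 \<le> s * recip_sum 0 q"
  shows "of_int p / real q + 1 / real q ^ 2 \<le> translation_number (pl_family L (\<tau> + s))"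
proof -
  let ?v = "pl_family L (\<tau> + s)"
  interpret v: circle_lift ?v by (rule circle_lift_pl_family[OF L])
  obtain x where x: "x 0 = b" "\<And>i. gap (x i) (x (Suc i))" "b + 1 \<le> x q" using ex_gap_chain by blast
  have "x n + of_int (int n * p) \<le> (?v ^^ (q * n)) b" for n
  proof (induction n)
    case (Suc n)
    have "x (Suc n) + of_int (int (Suc n) * p) \<le> (?v ^^ q) (x n) + of_int (int n * p)"
      using gap_cross_right[OF s x(2)[of n]] by (simp add: algebra_simps)
    also have "\<dots> = (?v ^^ q) (x n + of_int (int n * p))" by (simp only: v.iter_shift)
    also have "\<dots> \<le> (?v ^^ q) ((?v ^^ (q * n)) b)" by (rule v.iter_mono[OF Suc])
    also have "\<dots> = (?v ^^ (q * Suc n)) b" by (simp add: funpow_add)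
    finally show ?case .
  qed (simp add: x)
  from this[of q] have "b + of_int (1 + int q * p) \<le> (?v ^^ (q * q)) b" using x(3) by simp
  then have "of_int (1 + int q * p) / real (q * q) \<le> translation_number ?v" using q_pos by (intro v.translation_number_ge) auto
  then show ?thesis using q_pos by (simp add: field_simps power2_eq_square)
qed

lemma translation_number_far_left:
  assumes s: "0 \<le> s" "2 \<le> s * recip_sum 0 q"
  shows "translation_number (pl_family L (\<tau> - s)) \<le> of_int p / real q - 1 / real q ^ 2"
proof -
  let ?v = "pl_family L (\<tau> - s)"
  interpret v: circle_lift ?v by (rule circle_lift_pl_family[OF L])
  obtain x where x: "x 0 = b" "\<And>i. gap (x i) (x (Suc i))" "b + 1 \<le> x q" using ex_gap_chain by blast
  \<comment> \<open>Mirrored count: the starting point moves right along the chain while the target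
    stays a translate of \<open>b\<close>.\<close>
  have "(?v ^^ (q * n)) (x n) \<le> b + of_int (int n * p)" for n
  proof (induction n)
    case (Suc n)
    have "(?v ^^ (q * Suc n)) (x (Suc n)) = (?v ^^ (q * n)) ((?v ^^ q) (x (Suc n)))"
      by (metis add.commute comp_apply funpow_add mult_Suc_right)
    also have "\<dots> \<le> (?v ^^ (q * n)) (x n + of_int p)"
      by (rule v.iter_mono[OF gap_cross_left[OF s x(2)]])
    also have "\<dots> \<le> b + of_int (int (Suc n) * p)"
      unfolding v.iter_shift using Suc by (simp add: algebra_simps)
    finally show ?case .
  qed (simp add: x)
  from this[of q] v.iter_mono[OF x(3), of "q * q"]
  have "(?v ^^ (q * q)) (b + of_int 1) \<le> b + of_int (int q * p)" by simp
  then have "(?v ^^ (q * q)) b \<le> b + of_int (int q * p - 1)" unfolding v.iter_shift by simp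
  then have "translation_number ?v \<le> of_int (int q * p - 1) / real (q * q)" using q_pos by (intro v.translation_number_le) auto
  then show ?thesis using q_pos by (simp add: field_simps power2_eq_square)
qed

end

section \<open>Irrational rotation numbers have measure zero in the family\<close>

text \<open>Vitali's theorem covers almost all of \<open>S\<close> by disjoint balls inside a
  slightly larger open set. As each ball misses a fixed proportion of \<open>S\<close>, a positive
  measure would be smaller than itself.\<close>

lemma negligible_if_porous_lmeasurable:
  fixes S :: "'a::euclidean_space set"
  assumes S: "S \<in> lmeasurable" and \<eta>: "0 < \<eta>" "\<eta> < 1"
    and porous: "\<And>x d. x \<in> S \<Longrightarrow> 0 < d \<Longrightarrow> \<exists>a r. 0 < r \<and> r < d \<and> x \<in> cball a r \<and>
      measure lebesgue (S \<inter> cball a r) \<le> (1 - \<eta>) * measure lebesgue (cball a r)"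
  shows "negligible S"
proof (rule ccontr)
  let ?\<mu> = "measure lebesgue :: 'a set \<Rightarrow> real"
  assume "\<not> negligible S"
  then have pos: "0 < ?\<mu> S"
    using negligible_iff_measure0[OF S] by (simp add: zero_less_measure_iff)
  \<comment> \<open>With this choice the final bound is \<open>(1 - \<eta>) * (1 + \<eta>)\<close>
    times the measure of \<open>S\<close>, and the factor is below 1.\<close>
  define \<epsilon> where "\<epsilon> = \<eta> * ?\<mu> S"
  have "0 < \<epsilon>" using pos \<eta> by (simp add: \<epsilon>_def)
  then obtain U where U: "open U" "S \<subseteq> U" "U - S \<in> lmeasurable" "emeasure lebesgue (U - S) < ennreal \<epsilon>"
    using sets_lebesgue_outer_open[of S \<epsilon>] S by blast
  have US: "U = S \<union> (U - S)" using U(2) by auto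
  then have Um: "U \<in> lmeasurable" using S U(3) fmeasurable.Un by metis
  have "?\<mu> (U - S) < \<epsilon>"
    using U(3,4) \<open>0 < \<epsilon>\<close> by (simp add: emeasure_eq_measure2 ennreal_less_iff)
  then have Ulen: "?\<mu> U < ?\<mu> S + \<epsilon>"
    using measure_Un_le[of S lebesgue "U - S"] S U(3) US by (auto simp: fmeasurableD)
  define K where "K = {(a, r). 0 < r \<and> cball a r \<subseteq> U \<and> ?\<mu> (S \<inter> cball a r) \<le> (1 - \<eta>) * ?\<mu> (cball a r)}"
  obtain C where C: "countable C" "C \<subseteq> K"
    "pairwise (\<lambda>i j. disjnt (cball (fst i) (snd i)) (cball (fst j) (snd j))) C"
    "negligible (S - (\<Union>i\<in>C. cball (fst i) (snd i)))"
  proof (rule Vitali_covering_theorem_cballs[of K snd S fst])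
    show "0 < snd i" if "i \<in> K" for i using that by (auto simp: K_def)
    fix x and d :: real assume x: "x \<in> S" and d: "0 < d"
    obtain \<delta> where \<delta>: "0 < \<delta>" "ball x \<delta> \<subseteq> U"
      using U(1,2) x by (meson open_contains_ball subsetD)
    then have "0 < min d (\<delta> / 2)" using d by simp
    from porous[OF x this] obtain a r where ar: "0 < r" "r < min d (\<delta> / 2)" "x \<in> cball a r"
      "?\<mu> (S \<inter> cball a r) \<le> (1 - \<eta>) * ?\<mu> (cball a r)" by blast
    have "cball a r \<subseteq> ball x \<delta>"
    proof
      fix y assume "y \<in> cball a r"
      then have "dist x y \<le> r + r"
        using ar(3) dist_triangle[of x y a] by (simp add: dist_commute)
      then show "y \<in> ball x \<delta>" using ar(2) by simp
    qed
    then have "(a, r) \<in> K" unfolding K_def using ar \<delta> by auto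
    then show "\<exists>i. i \<in> K \<and> x \<in> cball (fst i) (snd i) \<and> snd i < d"
      using ar by (intro exI[of _ "(a, r)"]) auto
  qed (use that in blast)
  define B where "B = (\<lambda>i::'a \<times> real. cball (fst i) (snd i))"
  have B: "B i \<in> lmeasurable" "S \<inter> B i \<in> lmeasurable" for i
    unfolding B_def using S by (auto intro: fmeasurable.Int)
  have fin: "?\<mu> (\<Union>i\<in>I. S \<inter> B i) \<le> (1 - \<eta>) * ?\<mu> U" if I: "I \<subseteq> C" "finite I" for I
  proof -
    have "?\<mu> (\<Union>i\<in>I. S \<inter> B i) \<le> (\<Sum>i\<in>I. ?\<mu> (S \<inter> B i))"
      using I B by (intro measure_UNION_le) (auto simp: fmeasurableD)
    also have "\<dots> \<le> (\<Sum>i\<in>I. (1 - \<eta>) * ?\<mu> (B i))"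
      using I C(2) by (intro sum_mono) (auto simp: K_def B_def)
    also have "\<dots> = (1 - \<eta>) * (\<Sum>i\<in>I. ?\<mu> (B i))" by (simp add: sum_distrib_left)
    also have "(\<Sum>i\<in>I. ?\<mu> (B i)) = ?\<mu> (\<Union>i\<in>I. B i)"
    proof (rule measure_negligible_finite_Union_image[symmetric])
      show "pairwise (\<lambda>x y. negligible (B x \<inter> B y)) I"
        using pairwise_subset[OF C(3) I(1)] by (simp add: pairwise_def B_def disjnt_def)
    qed (use I B in auto)
    also have "\<dots> \<le> ?\<mu> U"
    proof (rule measure_mono_fmeasurable)
      have "B i \<subseteq> U" if "i \<in> I" for i
        using that I(1) C(2) unfolding K_def B_def by (cases i) auto
      then show "(\<Union>i\<in>I. B i) \<subseteq> U" by blast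
      show "(\<Union>i\<in>I. B i) \<in> sets lebesgue" using I B by (intro sets.finite_UN) (auto simp: fmeasurableD)
    qed (rule Um)
    finally show ?thesis using \<eta> by (simp add: mult_left_mono)
  qed
  have "?\<mu> (\<Union>i\<in>C. S \<inter> B i) \<le> (1 - \<eta>) * ?\<mu> U"
    by (rule measure_UN_bound[OF C(1) B(2) fin])
  also have "?\<mu> (\<Union>i\<in>C. S \<inter> B i) = ?\<mu> S"
  proof (rule measure_negligible_symdiff[OF S])
    show "negligible (sym_diff S (\<Union>i\<in>C. S \<inter> B i))"
      by (rule negligible_subset[OF C(4)]) (auto simp: B_def)
  qed
  finally have "?\<mu> S \<le> (1 - \<eta>) * (?\<mu> S + \<epsilon>)"
    using Ulen \<eta> mult_left_mono[of "?\<mu> U" "?\<mu> S + \<epsilon>" "1 - \<eta>"] by linarith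
  also have "\<dots> < ?\<mu> S" using pos \<eta> unfolding \<epsilon>_def by (simp add: algebra_simps power2_eq_square)
  finally show False by simp
qed

lemma negligible_if_porous:
  fixes S :: "'a::euclidean_space set"
  assumes S: "S \<in> sets lebesgue" and \<eta>: "0 < \<eta>" "\<eta> < 1"
    and porous: "\<And>x d. x \<in> S \<Longrightarrow> 0 < d \<Longrightarrow> \<exists>a r. 0 < r \<and> r < d \<and> x \<in> cball a r \<and>
      measure lebesgue (S \<inter> cball a r) \<le> (1 - \<eta>) * measure lebesgue (cball a r)"
  shows "negligible S"
proof -
  have "negligible (S \<inter> cball 0 (real n))" for n
  proof (rule negligible_if_porous_lmeasurable[OF _ \<eta>])
    show "S \<inter> cball 0 (real n) \<in> lmeasurable"
      using fmeasurable_Int_fmeasurable[OF lmeasurable_cball S] by (simp add: Int_commute)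
    fix x and d :: real assume "x \<in> S \<inter> cball 0 (real n)" "0 < d"
    then obtain a r where ar: "0 < r" "r < d" "x \<in> cball a r"
      "measure lebesgue (S \<inter> cball a r) \<le> (1 - \<eta>) * measure lebesgue (cball a r)"
      using porous by (metis IntD1)
    have "measure lebesgue (S \<inter> cball 0 (real n) \<inter> cball a r) \<le> measure lebesgue (S \<inter> cball a r)"
    proof (rule measure_mono_fmeasurable)
      show "S \<inter> cball 0 (real n) \<inter> cball a r \<in> sets lebesgue"
        using S by (intro sets.Int) (auto simp: fmeasurableD)
      show "S \<inter> cball a r \<in> lmeasurable"
        using fmeasurable_Int_fmeasurable[OF lmeasurable_cball S, of a r] by (simp add: Int_commute)
    qed auto
    then show "\<exists>a r. 0 < r \<and> r < d \<and> x \<in> cball a r \<and>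
      measure lebesgue (S \<inter> cball 0 (real n) \<inter> cball a r) \<le> (1 - \<eta>) * measure lebesgue (cball a r)"
      using ar by (intro exI[of _ a] exI[of _ r]) auto
  qed
  then have "negligible (\<Union>n. S \<inter> cball 0 (real n))" by (intro negligible_countable_Union) auto
  moreover have "S \<subseteq> (\<Union>n. S \<inter> cball 0 (real n))" using real_arch_simple by fastforce
  ultimately show ?thesis by (rule negligible_subset)
qed

section \<open>Measurability in the parameters, and nullity for fixed \<open>L\<close>\<close>

lemma measurable_translation_number_pl_family:
  "(\<lambda>z. translation_number (pl_family (fst z) (snd z))) \<in> borel_measurable borel"
proof -
  have "(\<lambda>z. (pl_family (fst z) (snd z) ^^ n) 0) \<in> borel_measurable borel" for n
  proof (induction n)
    case (Suc n)
    note [measurable] = Suc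
    have [measurable]: "fst \<in> borel_measurable (borel :: (real \<times> real) measure)"
      "snd \<in> borel_measurable (borel :: (real \<times> real) measure)"
      by (auto intro!: borel_measurable_continuous_onI continuous_intros)
    have "(\<lambda>z. pl_lift (fst z) ((pl_family (fst z) (snd z) ^^ n) 0) + snd z) \<in> borel_measurable borel"
      unfolding pl_lift_def frac_def by measurable
    then show ?case by (simp add: pl_family_def[of _ _ "(pl_family _ _ ^^ n) 0"])
  qed simp
  then show ?thesis unfolding translation_number_def by measurable
qed

lemma irrational_parameters_measurable:
  "{z. translation_number (pl_family (fst z) (snd z)) \<notin> \<rat>} \<in> sets borel"
proof -
  have "(\<rat> :: real set) \<in> sets borel" by (rule sets.countable[OF _ countable_rat]) simp
  then have "(- \<rat> :: real set) \<in> sets borel" by auto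
  from measurable_sets[OF measurable_translation_number_pl_family this]
  show ?thesis by (simp add: vimage_def)
qed

lemma irrational_parameters_measurable_slice:
  "{\<tau>. translation_number (pl_family L \<tau>) \<notin> \<rat>} \<in> sets borel"
proof -
  have "(\<lambda>\<tau>. (L, \<tau>)) \<in> borel_measurable borel"
    by (intro borel_measurable_continuous_onI continuous_intros)
  from measurable_sets[OF this irrational_parameters_measurable] show ?thesis by (simp add: vimage_def)
qed

lemma irrational_parameters_null:
  assumes L: "1 < L"
  shows "negligible {\<tau>. translation_number (pl_family L \<tau>) \<notin> \<rat>}"
proof (rule negligible_if_porous)
  define S where "S = {\<tau>. translation_number (pl_family L \<tau>) \<notin> \<rat>}"
  define \<kappa> where "\<kappa> = (L - 1) / (L + 1)"
  have \<kappa>: "0 < \<kappa>" "\<kappa> < 1" using L by (auto simp: \<kappa>_def)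
  \<comment> \<open>The quarter compares the plateau, of length \<open>\<kappa> / \<Sigma>\<close>,
    with a ball of radius \<open>2 / \<Sigma>\<close>, hence of length
    \<open>4 / \<Sigma>\<close>.\<close>
  show "0 < \<kappa> / 4" "\<kappa> / 4 < 1" using \<kappa> by auto
  have S: "S \<in> sets lebesgue" unfolding S_def
    using irrational_parameters_measurable_slice by (intro sets_completionI_sets) simp
  then show "{\<tau>. translation_number (pl_family L \<tau>) \<notin> \<rat>} \<in> sets lebesgue" by (simp add: S_def)
  fix \<tau>\<^sub>0 d :: real
  assume "\<tau>\<^sub>0 \<in> {\<tau>. translation_number (pl_family L \<tau>) \<notin> \<rat>}" and d: "0 < d"
  then have irr: "translation_number (pl_family L \<tau>\<^sub>0) \<notin> \<rat>" by simp
  obtain N :: nat where N: "2 / d < real N" using reals_Archimedean2 by blast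
  obtain p :: int and q :: nat where pq: "odd q" "coprime p (int q)" "N \<le> q"
    and err: "\<bar>real q * translation_number (pl_family L \<tau>\<^sub>0) - of_int p\<bar> < 1 / real q"
    using irrational_odd_approximation[OF irr] .
  have q: "0 < q" using pq(1) by (cases q) auto
  obtain \<tau>\<^sub>1 where \<tau>\<^sub>1: "(pl_family L \<tau>\<^sub>1 ^^ q) (pl_break L) = pl_break L + of_int p"
    using ex_periodic_parameter[OF L q] .
  interpret periodic_break L \<tau>\<^sub>1 q p using L pq \<tau>\<^sub>1 by unfold_locales
  define \<Sigma> where "\<Sigma> = recip_sum 0 q"
  have \<Sigma>: "real N \<le> \<Sigma>" "0 < \<Sigma>" using recip_sum_ge pq(3) q unfolding \<Sigma>_def by linarith+
  have r: "0 < 2 / \<Sigma>" "2 / \<Sigma> < d"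
  proof -
    have "2 / d < \<Sigma>" using N \<Sigma> by linarith
    then show "2 / \<Sigma> < d" using d \<Sigma> by (simp add: field_simps)
  qed (use \<Sigma> in simp)
  have err': "\<bar>translation_number (pl_family L \<tau>\<^sub>0) - of_int p / real q\<bar> < 1 / real q ^ 2"
  proof -
    have "\<bar>translation_number (pl_family L \<tau>\<^sub>0) - of_int p / real q\<bar>
        = \<bar>real q * translation_number (pl_family L \<tau>\<^sub>0) - of_int p\<bar> / real q"
    proof -
      have "translation_number (pl_family L \<tau>\<^sub>0) - of_int p / real q
          = (real q * translation_number (pl_family L \<tau>\<^sub>0) - of_int p) / real q"
        using q by (simp add: diff_divide_distrib)
      then show ?thesis by simp
    qed
    also have "\<dots> < 1 / real q / real q" using err q by (intro divide_strict_right_mono) auto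
    finally show ?thesis by (simp add: power2_eq_square)
  qed
  \<comment> \<open>Farther away, the translation number would differ from \<open>p / q\<close> by
    at least \<open>1 / q ^ 2\<close>, contradicting \<open>err'\<close>.\<close>
  have "\<tau>\<^sub>0 \<le> \<tau>\<^sub>1 + 2 / \<Sigma>"
  proof (rule ccontr)
    assume "\<not> ?thesis"
    then have "2 / \<Sigma> \<le> \<tau>\<^sub>0 - \<tau>\<^sub>1" by simp
    then have "0 \<le> \<tau>\<^sub>0 - \<tau>\<^sub>1" "2 \<le> (\<tau>\<^sub>0 - \<tau>\<^sub>1) * \<Sigma>"
      using \<Sigma>(2) r(1) by (linarith, simp add: pos_divide_le_eq)
    from translation_number_far_right[OF this[unfolded \<Sigma>_def]] show False using err' by simp
  qed
  moreover have "\<tau>\<^sub>1 - 2 / \<Sigma> \<le> \<tau>\<^sub>0"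
  proof (rule ccontr)
    assume "\<not> ?thesis"
    then have "2 / \<Sigma> \<le> \<tau>\<^sub>1 - \<tau>\<^sub>0" by simp
    then have "0 \<le> \<tau>\<^sub>1 - \<tau>\<^sub>0" "2 \<le> (\<tau>\<^sub>1 - \<tau>\<^sub>0) * \<Sigma>"
      using \<Sigma>(2) r(1) by (linarith, simp add: pos_divide_le_eq)
    from translation_number_far_left[OF this[unfolded \<Sigma>_def]] show False using err' by simp
  qed
  ultimately have mem: "\<tau>\<^sub>0 \<in> cball \<tau>\<^sub>1 (2 / \<Sigma>)" by (simp add: dist_real_def abs_le_iff)
  let ?P = "{\<tau>\<^sub>1..\<tau>\<^sub>1 + \<kappa> / \<Sigma>}"
  have "\<tau> \<notin> S" if "\<tau> \<in> ?P" for \<tau>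
  proof -
    have "0 \<le> \<tau> - \<tau>\<^sub>1" "(\<tau> - \<tau>\<^sub>1) * \<Sigma> \<le> \<kappa>" using that \<Sigma> by (auto simp: field_simps)
    from translation_number_plateau[OF this[unfolded \<Sigma>_def \<kappa>_def]]
    have "translation_number (pl_family L \<tau>) = of_int p / real q" by simp
    then show ?thesis by (simp add: S_def)
  qed
  then have sub: "S \<inter> cball \<tau>\<^sub>1 (2 / \<Sigma>) \<subseteq> cball \<tau>\<^sub>1 (2 / \<Sigma>) - ?P" by auto
  have Psub: "?P \<subseteq> cball \<tau>\<^sub>1 (2 / \<Sigma>)"
  proof -
    have "\<kappa> / \<Sigma> \<le> 2 / \<Sigma>" using \<kappa> \<Sigma> by (intro divide_right_mono) auto
    then show ?thesis by (auto simp: dist_real_def)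
  qed
  have ball: "measure lebesgue (cball \<tau>\<^sub>1 (2 / \<Sigma>)) = 4 / \<Sigma>"
    using r(1) by (simp add: cball_eq_atLeastAtMost)
  have "measure lebesgue (S \<inter> cball \<tau>\<^sub>1 (2 / \<Sigma>)) \<le> measure lebesgue (cball \<tau>\<^sub>1 (2 / \<Sigma>) - ?P)"
    using sub S by (intro measure_mono_fmeasurable) (auto intro: fmeasurable.Diff)
  also have "\<dots> = 4 / \<Sigma> - \<kappa> / \<Sigma>"
    using Psub \<kappa> \<Sigma> ball by (subst measurable_measure_Diff) auto
  also have "\<dots> = (1 - \<kappa> / 4) * measure lebesgue (cball \<tau>\<^sub>1 (2 / \<Sigma>))"
    unfolding ball by (simp add: algebra_simps)
  finally show "\<exists>a r. 0 < r \<and> r < d \<and> \<tau>\<^sub>0 \<in> cball a r \<and>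
      measure lebesgue ({\<tau>. translation_number (pl_family L \<tau>) \<notin> \<rat>} \<inter> cball a r)
        \<le> (1 - \<kappa> / 4) * measure lebesgue (cball a r)"
    unfolding S_def using r mem by blast
qed

section \<open>The first-return map of the trapezoid\<close>

text \<open>Together with \<open>fold_height_attained\<close> this identifies
  \<open>fold_height\<close> as the distance to the nearest integer, which yields the Lipschitz
  bound.\<close>

lemma fold_height_le: "fold_height y \<le> \<bar>y - of_int n\<bar>"
proof -
  have f: "0 \<le> frac y" "frac y < 1" by (auto simp: frac_lt_1)
  have y: "y = of_int \<lfloor>y\<rfloor> + frac y" by (simp add: frac_def)
  consider "n \<le> \<lfloor>y\<rfloor>" | "\<lfloor>y\<rfloor> + 1 \<le> n" by linarith
  then show ?thesis
  proof cases
    case 1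
    then have "real_of_int n \<le> of_int \<lfloor>y\<rfloor>" by simp
    then show ?thesis using y f unfolding fold_height_def by linarith
  next
    case 2
    then have "real_of_int (\<lfloor>y\<rfloor> + 1) \<le> of_int n" by (simp only: of_int_le_iff)
    then have "real_of_int \<lfloor>y\<rfloor> + 1 \<le> of_int n" by simp
    then show ?thesis using y f unfolding fold_height_def by linarith
  qed
qed

lemma fold_height_attained: "\<exists>n. fold_height y = \<bar>y - of_int n\<bar>"
proof -
  have f: "0 \<le> frac y" "frac y < 1" by (auto simp: frac_lt_1)
  have y: "y = of_int \<lfloor>y\<rfloor> + frac y" by (simp add: frac_def)
  then have "frac y = \<bar>y - of_int \<lfloor>y\<rfloor>\<bar>" "1 - frac y = \<bar>y - of_int (\<lfloor>y\<rfloor> + 1)\<bar>"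
    using f unfolding of_int_add of_int_1 by linarith+
  then show ?thesis unfolding fold_height_def min_def by metis
qed

lemma fold_height_lipschitz: "fold_height x - fold_height y \<le> \<bar>x - y\<bar>"
proof -
  obtain n where "fold_height y = \<bar>y - of_int n\<bar>" using fold_height_attained by blast
  then show ?thesis using fold_height_le[of x n] by linarith
qed

lemma fold_height_bounds: "0 \<le> fold_height y" "fold_height y \<le> 1"
  unfolding fold_height_def using frac_ge_0[of y] frac_lt_1[of y] by auto

lemma continuous_fold_height: "continuous_on UNIV fold_height"
proof (rule lipschitz_on_continuous_on)
  show "1-lipschitz_on UNIV fold_height"
  proof (rule lipschitz_onI)
    show "dist (fold_height x) (fold_height y) \<le> 1 * dist x y" for x y
      using fold_height_lipschitz[of x y] fold_height_lipschitz[of y x] by (simp add: dist_real_def)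
  qed simp
qed

text \<open>As \<open>u\<close> varies it parametrises the graph of \<open>pl_lift\<close>: on the
  first half of a cell the two coordinates have slopes \<open>1 - k\<close> and
  \<open>1 + k\<close>, on the second half these are exchanged, and their ratio is \<open>L\<close>
  or \<open>1 / L\<close>.\<close>

lemma pl_lift_fold_height:
  assumes k: "0 < k" "k < 1"
  shows "pl_lift ((1 + k) / (1 - k)) (u - k * fold_height u) = u + k * fold_height u"
proof -
  define L where "L = (1 + k) / (1 - k)"
  define n w where "n = \<lfloor>u\<rfloor>" and "w = frac u"
  have L: "1 < L" using k by (simp add: L_def)
  have b: "pl_break L = (1 - k) / 2" using k by (simp add: pl_break_def L_def field_simps)
  have w: "0 \<le> w" "w < 1" by (auto simp: w_def frac_lt_1)
  have u: "u = of_int n + w" by (simp add: n_def w_def frac_def)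
  have "pl_lift L (u - k * fold_height u) = u + k * fold_height u"
  proof (cases "w \<le> 1 / 2")
    case True
    then have h: "fold_height u = w" by (simp add: fold_height_def w_def)
    have "(1 - k) * w \<le> (1 - k) * (1 / 2)" using True k by (intro mult_left_mono) auto
    moreover have "0 \<le> (1 - k) * w" using w k by simp
    moreover have x: "u - k * fold_height u = of_int n + (1 - k) * w" unfolding h using u by (simp add: algebra_simps)
    ultimately have "pl_lift L (u - k * fold_height u) = of_int n + L * ((1 - k) * w)"
      using pl_lift_left[OF L, of n "u - k * fold_height u"] b by simp
    also have "L * ((1 - k) * w) = (1 + k) * w" using k by (simp add: L_def)
    finally show ?thesis unfolding h using u by (simp add: algebra_simps)
  next
    case False
    then have h: "fold_height u = 1 - w" by (simp add: fold_height_def w_def)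
    have "(1 + k) * (1 - w) \<le> (1 + k) * (1 / 2)" using False k by (intro mult_left_mono) auto
    moreover have "0 \<le> (1 + k) * (1 - w)" using w k by simp
    moreover have x: "u - k * fold_height u = of_int n + 1 - (1 + k) * (1 - w)" unfolding h using u by (simp add: algebra_simps)
    ultimately have "pl_lift L (u - k * fold_height u) = of_int n + 1 - ((1 + k) * (1 - w)) / L"
      using pl_lift_right[OF L, of n "u - k * fold_height u"] b by (simp add: diff_divide_distrib add_divide_distrib)
    also have "((1 + k) * (1 - w)) / L = (1 - k) * (1 - w)" using k by (simp add: L_def)
    finally show ?thesis unfolding h using u by (simp add: algebra_simps)
  qed
  then show ?thesis by (simp add: L_def)
qed

text \<open>For the admissible angles this is \<open>sin (t + a) / sin (t - a)\<close>, the larger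
  of the two derivative values of the return map.\<close>

definition slope_ratio :: "real \<Rightarrow> real \<Rightarrow> real" where
  "slope_ratio a t = (1 + tan a / tan t) / (1 - tan a / tan t)"

lemma slope_ratio_inverse:
  assumes "tan a / tan t < 1"
  shows "(slope_ratio a t - 1) / (slope_ratio a t + 1) = tan a / tan t"
proof -
  define k where "k = tan a / tan t"
  have "(1 + k) / (1 - k) - 1 = 2 * k / (1 - k)" "(1 + k) / (1 - k) + 1 = 2 / (1 - k)"
    using assms by (auto simp: k_def[symmetric] field_simps)
  then show ?thesis using assms by (simp add: slope_ratio_def k_def[symmetric])
qed

context
  fixes l a t :: real
  assumes l: "0 < l" and a: "0 < a" and at: "a < t" and t: "t < pi / 2"
begin

lemma trig_facts: "0 < tan a" "tan a < tan t" "0 < cos t" "0 < sin t" "cos t * tan a < sin t"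
proof -
  show ta: "0 < tan a" "tan a < tan t" using a at t by (auto intro: tan_gt_zero tan_monotone)
  show c: "0 < cos t" "0 < sin t" using a at t by (auto intro: cos_gt_zero sin_gt_zero2)
  have "cos t * tan a < cos t * tan t" using ta c by simp
  also have "cos t * tan t = sin t" using c by (simp add: tan_def)
  finally show "cos t * tan a < sin t" .
qed

text \<open>Since \<open>cos t * tan a < sin t\<close>, the ray gains on the slanted leg at every
  moment. So the difference has exactly one zero, and the description in \<open>hit_time\<close> is
  met by it alone.\<close>

lemma hit_time_equation:
  obtains s where "s = hit_time l a t y" "s * sin t = slant_x l a (y + s * cos t)"
proof -
  define \<phi> where "\<phi> s = s * sin t - slant_x l a (y + s * cos t)" for s
  have mono: "\<phi> r < \<phi> s" if "r < s" for r s
  proof -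
    have "fold_height (y + s * cos t) - fold_height (y + r * cos t) \<le> (s - r) * cos t"
      using fold_height_lipschitz[of "y + s * cos t" "y + r * cos t"] that trig_facts(3)
      by (simp add: left_diff_distrib[symmetric])
    then have "(fold_height (y + s * cos t) - fold_height (y + r * cos t)) * tan a \<le> (s - r) * cos t * tan a"
      using trig_facts(1) by (intro mult_right_mono) auto
    also have "\<dots> < (s - r) * sin t"
      using that trig_facts(5) by (simp add: mult.assoc)
    finally show ?thesis by (simp add: \<phi>_def slant_x_def algebra_simps)
  qed
  have neg: "\<phi> 0 < 0"
    using l mult_nonneg_nonneg[OF fold_height_bounds(1)[of y] less_imp_le[OF trig_facts(1)]]
    unfolding \<phi>_def slant_x_def by simp
  have "\<exists>s\<ge>0. s \<le> (l + tan a) / sin t \<and> \<phi> s = 0"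
  proof (rule IVT')
    show "\<phi> 0 \<le> 0" using neg by simp
    have "fold_height x * tan a \<le> 1 * tan a" for x
      using fold_height_bounds(2)[of x] trig_facts(1) by (intro mult_right_mono) auto
    then show "0 \<le> \<phi> ((l + tan a) / sin t)" using trig_facts by (simp add: \<phi>_def slant_x_def)
    show "0 \<le> (l + tan a) / sin t" using l trig_facts by simp
    show "continuous_on {0..(l + tan a) / sin t} \<phi>"
      unfolding \<phi>_def slant_x_def
      by (intro continuous_intros continuous_on_compose2[OF continuous_fold_height]) auto
  qed
  then obtain s where s: "0 \<le> s" "\<phi> s = 0" by blast
  have "s \<noteq> 0" using s neg by auto
  then have "0 < s" using s by simp
  have "hit_time l a t y = s"
    unfolding hit_time_def
  proof (rule the_equality)
    show "0 < s \<and> s * sin t = slant_x l a (y + s * cos t) \<and>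
      (\<forall>r. 0 < r \<and> r < s \<longrightarrow> r * sin t < slant_x l a (y + r * cos t))"
      using \<open>0 < s\<close> s mono[of _ s] unfolding \<phi>_def by auto
  next
    fix s' assume "0 < s' \<and> s' * sin t = slant_x l a (y + s' * cos t) \<and>
      (\<forall>r. 0 < r \<and> r < s' \<longrightarrow> r * sin t < slant_x l a (y + r * cos t))"
    then have "\<phi> s' = 0" by (simp add: \<phi>_def)
    then show "s' = s" using s mono[of s s'] mono[of s' s] by (cases s s' rule: linorder_cases) auto
  qed
  then show thesis using that[of s] s(2) by (simp add: \<phi>_def)
qed

lemma slope_ratio_gt_1: "1 < slope_ratio a t"
  using trig_facts by (simp add: slope_ratio_def field_simps)

text \<open>Let \<open>u\<close> be the unfolded height at the slanted leg. Both legs of the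
  trajectory rise by \<open>c + k * fold_height u\<close>, so start and return lie symmetrically
  about \<open>u\<close>, as in \<open>pl_lift_fold_height\<close>.\<close>

lemma trap_lift_conj:
  "trap_lift l a t y + l / tan t = pl_family (slope_ratio a t) (2 * (l / tan t)) (y + l / tan t)"
proof -
  define k c where "k = tan a / tan t" and "c = l / tan t"
  have k: "0 < k" "k < 1" using trig_facts by (auto simp: k_def)
  obtain s where s: "s = hit_time l a t y" "s * sin t = slant_x l a (y + s * cos t)"
    by (rule hit_time_equation)
  define u where "u = y + s * cos t"
  have "s * cos t = s * sin t / tan t" using trig_facts by (simp add: tan_def)
  also have "\<dots> = c + k * fold_height u"
    unfolding s(2) by (simp add: slant_x_def u_def c_def k_def add_divide_distrib)
  finally have sc: "s * cos t = c + k * fold_height u" .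
  have "pl_lift (slope_ratio a t) (y + c) = u + k * fold_height u"
  proof -
    have "y + c = u - k * fold_height u" using sc unfolding u_def by linarith
    then show ?thesis
      using pl_lift_fold_height[OF k, of u] unfolding slope_ratio_def k_def[symmetric] by simp
  qed
  moreover have "trap_lift l a t y = u + s * cos t"
    unfolding trap_lift_def s(1)[symmetric] u_def by simp
  ultimately show ?thesis unfolding pl_family_def c_def[symmetric] sc by simp
qed

text \<open>The conjugating translation moves the base point from 0 to \<open>c\<close>, and the
  translation number does not depend on the base point.\<close>

lemma rotation_number_trap_lift:
  "rotation_number (trap_lift l a t) = frac (translation_number (pl_family (slope_ratio a t) (2 * (l / tan t))))"
proof -
  define c where "c = l / tan t"
  let ?f = "pl_family (slope_ratio a t) (2 * c)"
  interpret f: circle_lift ?f by (rule circle_lift_pl_family[OF slope_ratio_gt_1])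
  have "(trap_lift l a t ^^ n) 0 + c = (?f ^^ n) c" for n
    by (induction n) (auto simp: trap_lift_conj[folded c_def])
  then have "(trap_lift l a t ^^ n) 0 - 0 = (?f ^^ n) c - c" for n
    by (simp add: eq_diff_eq)
  then have "(\<lambda>n. ((trap_lift l a t ^^ n) 0 - 0) / real n) \<longlonglongrightarrow> translation_number ?f"
    using f.tendsto_translation_number[of c] by simp
  then show ?thesis unfolding rotation_number_def c_def by (simp add: limI)
qed

end

section \<open>Fubini and the change of parameters\<close>

lemma irrational_parameters_null_plane:
  "negligible {z. 1 < fst z \<and> translation_number (pl_family (fst z) (snd z)) \<notin> \<rat>}" (is "negligible ?E")
proof -
  have fst: "{z. 1 < fst z} \<in> sets (borel :: (real \<times> real) measure)"
    by (intro borel_open open_Collect_less continuous_intros)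
  have "?E = {z. 1 < fst z} \<inter> {z. translation_number (pl_family (fst z) (snd z)) \<notin> \<rat>}" by auto
  then have E: "?E \<in> sets borel" using fst irrational_parameters_measurable by auto
  have "AE z in lborel \<Otimes>\<^sub>M lborel. z \<notin> ?E"
  proof (rule lborel_pair.AE_pair_measure)
    show "{z \<in> space (lborel \<Otimes>\<^sub>M lborel). z \<notin> ?E} \<in> sets (lborel \<Otimes>\<^sub>M lborel)"
    proof -
      have "{z \<in> space lborel. z \<notin> ?E} = - ?E" by auto
      then show ?thesis using borel_comp[OF E] unfolding lborel_prod by simp
    qed
    show "AE x in lborel. AE y in lborel. (x, y) \<notin> ?E"
    proof (rule AE_I2)
      fix x :: real
      show "AE y in lborel. (x, y) \<notin> ?E"
      \<comment> \<open>Slices at \<open>x\<close> up to 1 are empty; the others are null by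
        \<open>irrational_parameters_null\<close>.\<close>
      proof (cases "1 < x")
        case True
        have "AE y in lebesgue. y \<notin> {y. translation_number (pl_family x y) \<notin> \<rat>}"
          using irrational_parameters_null[OF True] unfolding negligible_iff_null_sets by (rule AE_not_in)
        then show ?thesis unfolding AE_completion_iff by (rule AE_mp) simp
      qed simp
    qed
  qed
  then have "AE z in lebesgue. z \<notin> ?E" unfolding lborel_prod AE_completion_iff .
  then have "?E \<in> null_sets lebesgue" using E by (subst AE_iff_null_sets) auto
  then show ?thesis by (simp add: negligible_iff_null_sets)
qed

theorem theorem3p2:
  fixes l :: real
  assumes "0 < l"
  shows "AE p in lborel. (0 < fst p \<and> fst p < snd p \<and> snd p < pi / 2) \<longrightarrow>
           rotation_number (trap_lift l (fst p) (snd p)) \<in> \<rat>"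
proof -
  define E where "E = {z. 1 < fst z \<and> translation_number (pl_family (fst z) (snd z)) \<notin> \<rat>} \<inter> {z. 0 < snd z}"
  \<comment> \<open>This inverts the passage from the angles to \<open>(L, \<tau>)\<close>:
    \<open>tan t = 2 * l / \<tau>\<close>, and \<open>tan a / tan t = (L - 1) / (L + 1)\<close>. It
    is differentiable at every point of \<open>E\<close>, so it maps this null set of the plane to a
    null set.\<close>
  define \<Phi> where "\<Phi> z = (arctan ((fst z - 1) / (fst z + 1) * (2 * l / snd z)), arctan (2 * l / snd z))"
    for z :: "real \<times> real"
  have "negligible E" unfolding E_def
    by (rule negligible_subset[OF irrational_parameters_null_plane]) auto
  moreover have "\<Phi> differentiable_on E"
  proof (rule differentiable_at_imp_differentiable_on)
    fix z assume "z \<in> E"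
    then have z: "fst z + 1 \<noteq> 0" "snd z \<noteq> 0" by (auto simp: E_def)
    have arctan: "arctan differentiable at x" for x
      using DERIV_arctan[of x] by (auto simp: real_differentiable_def)
    have proj: "fst differentiable at z" "snd differentiable at z"
      by (auto intro: bounded_linear_imp_differentiable bounded_linear_fst bounded_linear_snd)
    have 1: "(\<lambda>z. 2 * l / snd z) differentiable at z"
      using z proj by (intro differentiable_divide differentiable_const)
    have 2: "(\<lambda>z. (fst z - 1) / (fst z + 1) * (2 * l / snd z)) differentiable at z"
      using z proj 1
      by (intro differentiable_mult differentiable_divide differentiable_diff differentiable_add differentiable_const)
    show "\<Phi> differentiable at z"
      unfolding \<Phi>_def
      using differentiable_chain_at[OF 1 arctan] differentiable_chain_at[OF 2 arctan]
      by (intro differentiable_Pair) (simp_all add: o_def)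
  qed
  ultimately have "negligible (\<Phi> ` E)"
    by (intro negligible_differentiable_image_negligible) auto
  then have "AE z in lborel. z \<notin> \<Phi> ` E"
    unfolding negligible_iff_null_sets using AE_not_in AE_completion_iff by blast
  then show ?thesis
  proof (rule AE_mp, intro AE_I2 impI)
    fix z :: "real \<times> real"
    assume z: "z \<notin> \<Phi> ` E" and at: "0 < fst z \<and> fst z < snd z \<and> snd z < pi / 2"
    define a t where "a = fst z" and "t = snd z"
    note at' = at[folded a_def t_def]
    define L \<tau> where "L = slope_ratio a t" and "\<tau> = 2 * (l / tan t)"
    have facts: "0 < tan a" "tan a < tan t" using trig_facts[OF assms, of a t] at' by auto
    have L: "1 < L" using slope_ratio_gt_1[OF assms, of a t] at' by (simp add: L_def)
    have "2 * l / \<tau> = tan t" using assms facts by (simp add: \<tau>_def)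
    moreover have "(L - 1) / (L + 1) = tan a / tan t"
      using facts unfolding L_def by (intro slope_ratio_inverse) simp
    ultimately have "\<Phi> (L, \<tau>) = z"
      using facts at' by (simp add: \<Phi>_def arctan_tan a_def t_def)
    moreover have "0 < \<tau>" using assms facts by (simp add: \<tau>_def)
    ultimately have "translation_number (pl_family L \<tau>) \<in> \<rat>"
      using z L by (force simp: E_def)
    then show "rotation_number (trap_lift l (fst z) (snd z)) \<in> \<rat>"
      using rotation_number_trap_lift[OF assms, of a t] at'
      by (simp add: frac_in_Rats_iff L_def \<tau>_def a_def t_def)
  qed
qed

end
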